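(* For every lattice multi-polygon $\mathcal{P}$, $$\sharp\mathcal{P}=A(\mathcal{P})+\frac12 B(\mathcal{P})+C(\mathcal{P}).$$
   Context: A lattice multi-polygon is a sequence $\mathcal{P}=(v_1,\dots,v_d)$ of points of $\mathbb{Z}^2$, with $v_i\ne v_{i+1}$ for all $i$ (indices cyclic modulo $d$, $v_{d+1}=v_1$), regarded as an oriented closed piecewise linear loop obtained by joining $v_i$ to $v_{i+1}$ by a straight segment (the side $v_iv_{i+1}$), together with a sign $\epsilon(v_iv_{i+1})\in\{+1,-1\}$ for each side, such that whenever three consecutive points $v_{i-1},v_i,v_{i+1}$ lie on a line: (1) $\epsilon(v_{i-1}v_i)=\epsilon(v_iv_{i+1})$ if $v_i$ is in between $v_{i-1}$ and $v_{i+1}$; (2) $\epsilon(v_{i-1}v_i)\ne\epsilon(v_iv_{i+1})$ if $v_{i-1}$ lies on the segment $v_iv_{i+1}$ or $v_{i+1}$ lies on the segment $v_{i-1}v_i$. The loop may have self-intersections. For each $i$, $n_i$ denotes a normal vector to the side $v_iv_{i+1}$ such that the 90 degree (counterclockwise) rotation of $\epsilon(v_iv_{i+1})n_i$ has the same direction as the vector from $v_i$ to $v_{i+1}$. Because of (1) and (2), $n_i$ and $n_{i+1}$ never point in opposite directions. For $v\in\mathbb{R}^2$ not on any side of $\mathcal{P}$, $d_{\mathcal{P}}(v)$ is the winding number of the oriented loop $\mathcal{P}$ around $v$ (counterclockwise positive). Define: - $A(\mathcal{P})=\int_{\mathbb{R}^2\setminus\mathcal{P}}d_{\mathcal{P}}(v)\,dv$,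 where $\mathbb{R}^2\setminus\mathcal{P}$ is the set of points lying on no side of $\mathcal{P}$. - $B(\mathcal{P})=\sum_{i=1}^d\epsilon(v_iv_{i+1})\,|v_iv_{i+1}|$, where $|v_iv_{i+1}|$ is the number of lattice points on the segment $v_iv_{i+1}$ minus $1$. - $C(\mathcal{P})$ is the rotation number of the sequence $n_1,\dots,n_d$ around the origin, that is, $\frac1{2\pi}\sum_{i=1}^d\theta_i$, where $\theta_i\in(-\pi,\pi)$ is the signed angle (counterclockwise positive) from $n_i$ to $n_{i+1}$, with $n_{d+1}=n_1$. - $\sharp\mathcal{P}=\sum_{u\in\mathbb{Z}^2}d_{\mathcal{P}_+}(u)$, where $\mathcal{P}_+$ is the oriented loop obtained from $\mathcal{P}$ by pushing each side $v_iv_{i+1}$ slightly in the direction of $n_i$. Explicitly, take $n_i$ of unit length and let $\delta>0$ be sufficiently small. The line of the side $v_iv_{i+1}$ is translated by $\delta n_i$, and each vertex $v_i$ is replaced by the intersection point of the translated lines of the two sides meeting at $v_i$ (or by $v_i+\delta n_i$ if these two sides lie on one line, in which case $n_{i-1}$ and $n_i$ have the same direction). The loop $\mathcal{P}_+$ joins the successive new vertices by segments. It misses all lattice points, so the winding number $d_{\mathcal{P}_+}(u)$ around each $u\in\mathbb{Z}^2$ is defined. *)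

theory Defs
  imports "HOL-Complex_Analysis.Complex_Analysis"
begin

text \<open>
  The plane is identified with the complex numbers.  A multi-polygon is given by the list \<open>vs\<close>
  of its vertices and the list \<open>es\<close> of the signs of its sides; indices start at \<open>0\<close> and are
  cyclic, side \<open>i\<close> goes from vertex \<open>i\<close> to vertex \<open>i + 1\<close>, and \<open>es ! i\<close> is its sign.
\<close>

definition lattice :: "complex set" where
  "lattice = {z. Re z \<in> \<int> \<and> Im z \<in> \<int>}"

definition cyc :: "'a list \<Rightarrow> nat \<Rightarrow> 'a" where
  "cyc xs i = xs ! (i mod length xs)"

definition side :: "complex list \<Rightarrow> nat \<Rightarrow> complex set" where
  "side vs i = closed_segment (cyc vs i) (cyc vs (i + 1))"

definition lattice_multi_polygon :: "complex list \<Rightarrow> int list \<Rightarrow> bool" where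
  "lattice_multi_polygon vs es \<longleftrightarrow>
     vs \<noteq> [] \<and> length es = length vs \<and> set vs \<subseteq> lattice \<and> set es \<subseteq> {1, -1} \<and>
     (\<forall>i. cyc vs i \<noteq> cyc vs (i + 1)) \<and>
     (\<forall>i. collinear {cyc vs i, cyc vs (i + 1), cyc vs (i + 2)} \<longrightarrow>
        (cyc vs (i + 1) \<in> closed_segment (cyc vs i) (cyc vs (i + 2)) \<longrightarrow>
           cyc es i = cyc es (i + 1)) \<and>
        (cyc vs i \<in> side vs (i + 1) \<or> cyc vs (i + 2) \<in> side vs i \<longrightarrow>
           cyc es i \<noteq> cyc es (i + 1)))"

text \<open>
  Multiplication by \<open>\<i>\<close> is the counterclockwise rotation by 90 degrees, so the unit normal
  \<open>n\<close> with \<open>\<i> * (\<epsilon> * n)\<close> in the direction of the side is obtained with the factor \<open>- \<i>\<close>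
  (and \<open>\<epsilon> = 1 / \<epsilon>\<close>).
\<close>

definition normal_vec :: "complex list \<Rightarrow> int list \<Rightarrow> nat \<Rightarrow> complex" where
  "normal_vec vs es i = sgn (- \<i> * of_int (cyc es i) * (cyc vs (i + 1) - cyc vs i))"

fun polygonal_path :: "complex list \<Rightarrow> real \<Rightarrow> complex" where
  "polygonal_path [] = linepath 0 0"
| "polygonal_path [a] = linepath a a"
| "polygonal_path [a, b] = linepath a b"
| "polygonal_path (a # b # c # xs) = linepath a b +++ polygonal_path (b # c # xs)"

definition closed_loop :: "complex list \<Rightarrow> real \<Rightarrow> complex" where
  "closed_loop vs = polygonal_path (vs @ [hd vs])"

text \<open>
  The library's winding number is complex-valued; off the image of a closed path it is an
  integer, so taking the real part loses nothing.
\<close>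

definition loop_winding :: "complex list \<Rightarrow> complex \<Rightarrow> real" where
  "loop_winding vs z = Re (winding_number (closed_loop vs) z)"

definition A_term :: "complex list \<Rightarrow> real" where
  "A_term vs = (LINT z : - (\<Union>i<length vs. side vs i) | lborel. loop_winding vs z)"

definition B_term :: "complex list \<Rightarrow> int list \<Rightarrow> real" where
  "B_term vs es =
     (\<Sum>i<length vs. of_int (cyc es i) * (real (card (side vs i \<inter> lattice)) - 1))"

text \<open>
  \<open>Arg (w / z)\<close> is the signed angle from \<open>z\<close> to \<open>w\<close>.  The library's \<open>Arg\<close> takes values in
  the half-open interval from \<open>-pi\<close> (excluded) to \<open>pi\<close> (included); the value \<open>pi\<close> does not
  occur here, as consecutive normals of a multi-polygon are never opposite.
\<close>

definition C_term :: "complex list \<Rightarrow> int list \<Rightarrow> real" where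
  "C_term vs es =
     1 / (2 * pi) * (\<Sum>i<length vs. Arg (normal_vec vs es (i + 1) / normal_vec vs es i))"

definition shifted_line :: "complex list \<Rightarrow> int list \<Rightarrow> real \<Rightarrow> nat \<Rightarrow> complex set" where
  "shifted_line vs es \<delta> i =
     (\<lambda>z. z + \<delta> *\<^sub>R normal_vec vs es i) ` (affine hull {cyc vs i, cyc vs (i + 1)})"

text \<open>
  Vertex \<open>i\<close> is the common endpoint of the sides \<open>i - 1\<close> and \<open>i\<close>.  The cyclic predecessor of
  \<open>i\<close> is written \<open>i + length vs - 1\<close> to avoid truncated subtraction at \<open>i = 0\<close>.
\<close>

definition shifted_vertex :: "complex list \<Rightarrow> int list \<Rightarrow> real \<Rightarrow> nat \<Rightarrow> complex" where
  "shifted_vertex vs es \<delta> i =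
     (let j = i + length vs - 1 in
      if collinear {cyc vs j, cyc vs i, cyc vs (i + 1)}
      then cyc vs i + \<delta> *\<^sub>R normal_vec vs es i
      else (THE p. p \<in> shifted_line vs es \<delta> j \<and> p \<in> shifted_line vs es \<delta> i))"

definition shifted_polygon :: "complex list \<Rightarrow> int list \<Rightarrow> real \<Rightarrow> complex list" where
  "shifted_polygon vs es \<delta> = map (shifted_vertex vs es \<delta>) [0..<length vs]"

text \<open>
  The lattice point count of the polygon pushed by \<open>\<delta>\<close>; it is meant for all sufficiently
  small \<open>\<delta> > 0\<close>.
\<close>

definition sharp :: "complex list \<Rightarrow> int list \<Rightarrow> real \<Rightarrow> real" where
  "sharp vs es \<delta> = (\<Sum>\<^sub>\<infinity>u\<in>lattice. loop_winding (shifted_polygon vs es \<delta>) u)"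

end

theory Submission
  imports Defs
begin

text \<open>
  The formula is proved by comparing two ways of counting winding numbers at lattice points.
  Let \<open>pv_winding vs u\<close> be the sum over the sides of the angle subtended at \<open>u\<close>, divided by
  \<open>2 * pi\<close>, where a side that contains \<open>u\<close> contributes \<open>0\<close>. Off the loop this is the winding
  number; on the loop it is the principal value of the winding integral.

  \<^bold>\<open>The principal values at the lattice points sum to the area.\<close> The subtended angle is
  antisymmetric in the two endpoints of a segment, for every position of \<open>u\<close>. Hence the principal
  value splits exactly, at every point of the plane, into those of the triangles
  \<open>0, v\<^sub>i, v\<^sub>i\<^sub>+\<^sub>1\<close>, and only a single lattice triangle has to be treated. Both the sum over the
  lattice and the Lebesgue integral of the principal value are functions of the triangle that are
  invariant under lattice translations and under the point reflection \<open>z \<mapsto> - z\<close>, alternating, and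
  such that both ways of cutting a quadrilateral along a diagonal give the same sum. Any such function of
  \<open>0, a, b\<close> is bilinear in \<open>a\<close> and \<open>b\<close>, so it is the determinant of \<open>a\<close> and \<open>b\<close> times its
  value on the triangle \<open>0, 1, \<i>\<close> (\<open>lattice_triangle_functional\<close>). On this
  triangle both functions are \<open>1 / 2\<close>: the integral is the area, and the three lattice points
  contribute the angles \<open>pi / 2\<close>, \<open>pi / 4\<close>, \<open>pi / 4\<close> divided by \<open>2 * pi\<close>.

  \<^bold>\<open>Pushing the sides adds the other two terms.\<close> The vertex \<open>v\<^sub>i\<close> moves to
  \<open>v\<^sub>i + \<delta> m\<^sub>i\<close> for a fixed vector \<open>m\<^sub>i\<close> whose inner product with both adjacent unit normals is \<open>1\<close>.
  As \<open>\<delta>\<close> tends to \<open>0\<close>, the angle subtended at \<open>u\<close> by a side that does not contain \<open>u\<close> is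
  continuous. If the side contains \<open>u\<close>, then the pushed side passes \<open>u\<close> on the side of its normal
  \<open>n\<^sub>i\<close>, and splitting the angle at the direction of \<open>n\<^sub>i\<close> gives two parts. Each part tends to
  \<open>\<epsilon>\<^sub>i * pi / 2\<close>, except that a part that ends at a vertex equal to \<open>u\<close> is
  the constant angle between \<open>n\<^sub>i\<close> and \<open>m\<close> at this vertex (\<open>tendsto_turn_pushed_side\<close>). As the
  winding number of the pushed loop is an integer, it is equal to its limit for all small \<open>\<delta>\<close>.
  The extra angles, summed over all lattice points and divided by \<open>2 * pi\<close>, consist of the
  \<open>\<epsilon>\<^sub>i * pi / 2\<close>, which give half of the boundary term, and of the angles from
  \<open>n\<^sub>i\<^sub>-\<^sub>1\<close> to \<open>m\<^sub>i\<close> and from \<open>m\<^sub>i\<close> to \<open>n\<^sub>i\<close>, which add up to the angle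
  from \<open>n\<^sub>i\<^sub>-\<^sub>1\<close> to \<open>n\<^sub>i\<close> and give the rotation number.
\<close>

section \<open>The angle subtended by a segment\<close>

text \<open>
  Counted in full turns. The value \<open>0\<close> on the segment itself is the principal value; it keeps
  the antisymmetry \<open>turn_swap\<close> valid at every point, where a jump to \<open>pi\<close> would break it.
\<close>
definition turn :: "complex \<Rightarrow> complex \<Rightarrow> complex \<Rightarrow> real" where
  "turn z a b = (if z \<in> closed_segment a b then 0 else Arg ((b - z) / (a - z)) / (2 * pi))"

lemma in_closed_segment_iff_ratio:
  fixes a b z :: complex
  shows "z \<in> closed_segment a b \<longleftrightarrow> (b - z) / (a - z) \<in> \<real>\<^sub>\<le>\<^sub>0"
proof
  assume "z \<in> closed_segment a b"
  then obtain u where u: "0 \<le> u" "u \<le> 1" and z: "z = (1 - u) *\<^sub>R a + u *\<^sub>R b"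
    by (auto simp: in_segment)
  have az: "a - z = of_real u * (a - b)" and bz: "b - z = of_real (u - 1) * (a - b)"
    by (auto simp: z scaleR_conv_of_real algebra_simps)
  have "(b - z) / (a - z) = of_real (if a = b then 0 else (u - 1) / u)"
    unfolding az bz by simp
  also have "\<dots> \<in> \<real>\<^sub>\<le>\<^sub>0"
    using u by (simp add: divide_nonpos_nonneg)
  finally show "(b - z) / (a - z) \<in> \<real>\<^sub>\<le>\<^sub>0" .
next
  assume "(b - z) / (a - z) \<in> \<real>\<^sub>\<le>\<^sub>0"
  then obtain r where r: "r \<le> 0" "(b - z) / (a - z) = of_real r"
    by (auto simp: nonpos_Reals_def)
  show "z \<in> closed_segment a b"
  proof (cases "a = z")
    case False
    have b: "b = z + of_real r * (a - z)"
      using r(2) False by (simp add: field_simps)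
    define u where "u = 1 / (1 - r)"
    have "0 \<le> u" "u \<le> 1"
      using r(1) by (auto simp: u_def)
    moreover have "1 - u + u * r = 0" using r(1) by (simp add: u_def field_simps)
    then have "of_real (1 - u + u * r) * (a - z) = 0" by simp
    then have "z = (1 - u) *\<^sub>R a + u *\<^sub>R b"
      by (simp add: b scaleR_conv_of_real algebra_simps)
    ultimately show ?thesis
      by (auto simp: in_segment)
  qed auto
qed

text \<open>
  Along a segment that avoids \<open>z\<close>, the quotient \<open>(w - z) / (a - z)\<close> stays off the negative real
  axis, so the principal logarithm of this quotient is a primitive of \<open>1 / (w - z)\<close>.
\<close>
lemma Re_winding_number_linepath:
  assumes "z \<notin> closed_segment a b"
  shows "Re (winding_number (linepath a b) z) = turn z a b"
proof -
  define L where "L w = Ln ((w - z) / (a - z))" for w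
  have az: "a \<noteq> z" and bz: "b \<noteq> z" using assms by auto
  have "((\<lambda>w. 1 / (w - z)) has_contour_integral (L (pathfinish (linepath a b)) - L (pathstart (linepath a b))))
          (linepath a b)"
  proof (rule contour_integral_primitive [where S = "closed_segment a b"])
    fix w assume w: "w \<in> closed_segment a b"
    then have "closed_segment a w \<subseteq> closed_segment a b"
      by (simp add: subset_closed_segment)
    then have n: "(w - z) / (a - z) \<notin> \<real>\<^sub>\<le>\<^sub>0"
      using assms by (auto simp flip: in_closed_segment_iff_ratio)
    then have "w \<noteq> z" by auto
    then show "(L has_field_derivative 1 / (w - z)) (at w within closed_segment a b)"
      unfolding L_def using n az
      by (auto intro!: derivative_eq_intros)
  qed auto
  then have "contour_integral (linepath a b) (\<lambda>w. 1 / (w - z)) = Ln ((b - z) / (a - z))"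
    using az by (auto simp: L_def dest!: contour_integral_unique)
  then have "winding_number (linepath a b) z = 1 / (2 * pi * \<i>) * Ln ((b - z) / (a - z))"
    using assms by (subst winding_number_valid_path) auto
  also have "\<dots> = - \<i> * (Ln ((b - z) / (a - z)) / of_real (2 * pi))"
    by (simp add: field_simps)
  finally have "Re (winding_number (linepath a b) z) = Im (Ln ((b - z) / (a - z)) / of_real (2 * pi))"
    by simp
  also have "\<dots> = Im (Ln ((b - z) / (a - z))) / (2 * pi)"
    by (rule Im_divide_of_real)
  finally show ?thesis
    using assms az bz by (simp add: turn_def Arg_eq_Im_Ln)
qed

lemma turn_swap: "turn z b a = - turn z a b"
proof (cases "z \<in> closed_segment a b")
  case True
  then show ?thesis by (auto simp: turn_def closed_segment_commute)
next
  case False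
  let ?r = "(b - z) / (a - z)"
  have n: "?r \<notin> \<real>\<^sub>\<le>\<^sub>0" using False by (simp add: in_closed_segment_iff_ratio)
  have "?r \<in> \<real> \<Longrightarrow> Arg ?r = 0"
    using n unfolding Arg_eq_0 complex_nonpos_Reals_iff complex_is_Real_iff by linarith
  then have "Arg (inverse ?r) = - Arg ?r"
    by (simp only: Arg_inverse split: if_splits) simp
  then have "Arg ((a - z) / (b - z)) = - Arg ?r"
    by (simp only: inverse_divide)
  then show ?thesis
    using False by (simp add: turn_def closed_segment_commute)
qed

lemma turn_translation: "turn (z + t) (a + t) (b + t) = turn z a b"
  by (simp add: turn_def closed_segment_translation_eq [of t, unfolded add.commute [of t]])

lemma turn_uminus: "turn (- z) (- a) (- b) = turn z a b"
proof -
  have "(- b - (- z)) / (- a - (- z)) = (b - z) / (a - z)"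
    using minus_divide_divide [of "b - z" "a - z"] by (simp add: algebra_simps)
  then show ?thesis by (simp only: turn_def in_closed_segment_iff_ratio)
qed

lemma abs_turn_le: "\<bar>turn z a b\<bar> \<le> 1"
proof -
  have "\<bar>Arg ((b - z) / (a - z))\<bar> \<le> pi" using mpi_less_Arg Arg_le_pi by (simp add: abs_le_iff less_imp_le minus_le_iff)
  then have "\<bar>Arg ((b - z) / (a - z))\<bar> \<le> 2 * pi" using pi_gt_zero by linarith
  then show ?thesis by (simp add: turn_def)
qed

lemma borel_measurable_turn [measurable]: "(\<lambda>z. turn z a b) \<in> borel_measurable borel"
proof -
  let ?U = "- closed_segment a b"
  have "continuous_on ?U (\<lambda>z. Arg ((b - z) / (a - z)) / (2 * pi))"
    by (intro continuous_intros) (auto simp flip: in_closed_segment_iff_ratio)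
  then have "(\<lambda>z. indicator ?U z *\<^sub>R (Arg ((b - z) / (a - z)) / (2 * pi))) \<in> borel_measurable borel"
    by (intro borel_measurable_continuous_on_indicator) auto
  also have "(\<lambda>z. indicator ?U z *\<^sub>R (Arg ((b - z) / (a - z)) / (2 * pi))) = (\<lambda>z. turn z a b)"
    by (auto simp: turn_def indicator_def)
  finally show ?thesis .
qed

section \<open>Winding numbers of polygonal loops\<close>

lemma path_polygonal_path: "path (polygonal_path xs)"
  and pathstart_polygonal_path: "xs \<noteq> [] \<Longrightarrow> pathstart (polygonal_path xs) = hd xs"
  and pathfinish_polygonal_path: "xs \<noteq> [] \<Longrightarrow> pathfinish (polygonal_path xs) = last xs"
  by (induction xs rule: polygonal_path.induct) auto

lemma path_image_polygonal_path:
  "length xs \<ge> 2 \<Longrightarrow>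
    path_image (polygonal_path xs) = (\<Union>i<length xs - 1. closed_segment (xs ! i) (xs ! Suc i))"
proof (induction xs rule: polygonal_path.induct)
  case (4 a b c xs)
  have "path_image (polygonal_path (a # b # c # xs)) =
     closed_segment a b \<union> path_image (polygonal_path (b # c # xs))"
    by (simp add: path_image_join pathstart_polygonal_path)
  also have "\<dots> = closed_segment a b \<union> (\<Union>i<Suc (length xs). closed_segment ((b # c # xs) ! i) ((b # c # xs) ! Suc i))"
    using 4 by simp
  also have "\<dots> = (\<Union>i<Suc (Suc (length xs)). closed_segment ((a # b # c # xs) ! i) ((a # b # c # xs) ! Suc i))"
    unfolding lessThan_Suc_eq_insert_0 [of "Suc (length xs)"] by simp
  finally show ?case by simp
qed (auto simp: lessThan_Suc)

lemma Re_winding_number_polygonal_path: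
  "length xs \<ge> 2 \<Longrightarrow> z \<notin> path_image (polygonal_path xs) \<Longrightarrow>
    Re (winding_number (polygonal_path xs) z) = (\<Sum>i<length xs - 1. turn z (xs ! i) (xs ! Suc i))"
proof (induction xs rule: polygonal_path.induct)
  case (4 a b c xs)
  have z: "z \<notin> closed_segment a b" "z \<notin> path_image (polygonal_path (b # c # xs))"
    using 4(3) by (auto simp: path_image_join pathstart_polygonal_path)
  have "winding_number (polygonal_path (a # b # c # xs)) z =
     winding_number (linepath a b) z + winding_number (polygonal_path (b # c # xs)) z"
    unfolding polygonal_path.simps
    by (rule winding_number_join) (use z in \<open>simp_all add: path_polygonal_path pathstart_polygonal_path\<close>)
  then have "Re (winding_number (polygonal_path (a # b # c # xs)) z) =
     turn z a b + (\<Sum>i<Suc (length xs). turn z ((b # c # xs) ! i) ((b # c # xs) ! Suc i))"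
    using 4(1) z by (simp add: Re_winding_number_linepath)
  also have "\<dots> = (\<Sum>i<Suc (Suc (length xs)). turn z ((a # b # c # xs) ! i) ((a # b # c # xs) ! Suc i))"
    unfolding sum.lessThan_Suc_shift [of _ "Suc (length xs)"] by simp
  finally show ?case by simp
qed (auto simp: Re_winding_number_linepath)

lemma closed_loop_nth:
  assumes "vs \<noteq> []" "i \<le> length vs"
  shows "(vs @ [hd vs]) ! i = cyc vs i"
  using assms by (cases "i = length vs") (auto simp: cyc_def nth_append hd_conv_nth)

lemma path_image_closed_loop:
  assumes "vs \<noteq> []"
  shows "path_image (closed_loop vs) = (\<Union>i<length vs. side vs i)"
  using assms
  by (simp add: closed_loop_def path_image_polygonal_path side_def closed_loop_nth Suc_le_eq)

text \<open>The principal value of the winding integral, defined at every point of the plane.\<close>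
definition pv_winding :: "complex list \<Rightarrow> complex \<Rightarrow> real" where
  "pv_winding vs z = (\<Sum>i<length vs. turn z (cyc vs i) (cyc vs (i + 1)))"

lemma loop_winding_eq_pv_winding:
  assumes "vs \<noteq> []" "z \<notin> (\<Union>i<length vs. side vs i)"
  shows "loop_winding vs z = pv_winding vs z"
  using assms
  by (simp add: loop_winding_def flip: path_image_closed_loop)
     (simp add: pv_winding_def closed_loop_def Re_winding_number_polygonal_path closed_loop_nth Suc_le_eq)

lemma path_closed_loop: "path (closed_loop vs)"
  by (simp add: closed_loop_def path_polygonal_path)

lemma closed_loop_loop: "vs \<noteq> [] \<Longrightarrow> pathfinish (closed_loop vs) = pathstart (closed_loop vs)"
  by (simp add: closed_loop_def pathstart_polygonal_path pathfinish_polygonal_path hd_append)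

lemma loop_winding_Ints:
  assumes "vs \<noteq> []" "z \<notin> (\<Union>i<length vs. side vs i)"
  shows "loop_winding vs z \<in> \<int>"
proof -
  have "winding_number (closed_loop vs) z \<in> \<int>"
    by (rule integer_winding_number)
      (use assms in \<open>auto simp: closed_loop_loop path_image_closed_loop path_closed_loop\<close>)
  then show ?thesis
    by (auto simp: loop_winding_def elim!: Ints_cases)
qed

lemma loop_winding_outside:
  assumes "vs \<noteq> []" "set vs \<subseteq> S" "convex S" "z \<notin> S"
  shows "loop_winding vs z = 0"
proof -
  have "side vs i \<subseteq> S" for i
    unfolding side_def using assms
    by (intro closed_segment_subset) (auto simp: cyc_def subset_iff)
  then have "winding_number (closed_loop vs) z = 0"
    using assms
    by (intro winding_number_zero_outside [where s = S])
      (auto simp: closed_loop_loop path_image_closed_loop path_closed_loop)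
  then show ?thesis by (simp add: loop_winding_def)
qed

section \<open>Functions of lattice triangles\<close>

lemma lattice_add [simp]: "a \<in> lattice \<Longrightarrow> b \<in> lattice \<Longrightarrow> a + b \<in> lattice"
  and lattice_uminus [simp]: "- a \<in> lattice \<longleftrightarrow> a \<in> lattice"
  and lattice_diff [simp]: "a \<in> lattice \<Longrightarrow> b \<in> lattice \<Longrightarrow> a - b \<in> lattice"
  and lattice_0 [simp]: "0 \<in> lattice" and lattice_1 [simp]: "1 \<in> lattice" and lattice_ii [simp]: "\<i> \<in> lattice"
  and lattice_of_int_mult [simp]: "a \<in> lattice \<Longrightarrow> of_int k * a \<in> lattice"
  by (auto simp: lattice_def minus_in_Ints_iff)

lemma finite_bounded_lattice:
  assumes "bounded S"
  shows "finite (S \<inter> lattice)"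
proof -
  obtain R where R: "\<And>z. z \<in> S \<Longrightarrow> norm z \<le> R"
    using assms by (auto simp: bounded_iff)
  define N where "N = \<lceil>R\<rceil>"
  have "S \<inter> lattice \<subseteq> (\<lambda>(x, y). Complex (of_int x) (of_int y)) ` ({-N..N} \<times> {-N..N})"
  proof
    fix z assume z: "z \<in> S \<inter> lattice"
    then obtain x y where xy: "Re z = of_int x" "Im z = of_int y"
      by (auto simp: lattice_def elim!: Ints_cases)
    have "\<bar>of_int x\<bar> \<le> R" "\<bar>of_int y\<bar> \<le> R"
      using R [of z] z abs_Re_le_cmod [of z] abs_Im_le_cmod [of z] by (auto simp: xy)
    then have "x \<in> {-N..N}" "y \<in> {-N..N}"
      unfolding N_def by (auto simp: abs_le_iff le_ceiling_iff minus_le_iff; linarith)+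
    moreover have "z = Complex (of_int x) (of_int y)"
      by (simp add: complex_eq_iff xy)
    ultimately show "z \<in> (\<lambda>(x, y). Complex (of_int x) (of_int y)) ` ({-N..N} \<times> {-N..N})"
      by force
  qed
  then show ?thesis
    by (rule finite_subset) auto
qed

lemma additive_on_lattice:
  fixes f :: "complex \<Rightarrow> real"
  assumes add: "\<And>a b. a \<in> lattice \<Longrightarrow> b \<in> lattice \<Longrightarrow> f (a + b) = f a + f b"
    and z: "z \<in> lattice"
  shows "f z = Re z * f 1 + Im z * f \<i>"
proof -
  have "f 0 = 0" using add [of 0 0] by simp
  have mult: "f (of_int k * w) = of_int k * f w" if w: "w \<in> lattice" for k :: int and w
  proof (induction k rule: int_induct [where k = 0])
    case base
    show ?case using \<open>f 0 = 0\<close> by simp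
  next
    case (step1 i)
    then show ?case
      using add [OF lattice_of_int_mult [OF w, of i] w] by (simp add: ring_distribs)
  next
    case (step2 i)
    then show ?case
      using add [OF lattice_of_int_mult [OF w, of "i - 1"] w] by (simp add: ring_distribs)
  qed
  obtain x y where xy: "Re z = of_int x" "Im z = of_int y"
    using z by (auto simp: lattice_def elim!: Ints_cases)
  have "z = of_int x * 1 + of_int y * \<i>"
    by (simp add: complex_eq_iff xy)
  then have "f z = f (of_int x * 1) + f (of_int y * \<i>)"
    using add [of "of_int x * 1" "of_int y * \<i>"] by (simp only: lattice_of_int_mult lattice_1 lattice_ii)
  then show ?thesis
    by (simp only: mult lattice_1 lattice_ii xy)
qed

text \<open>
  Two congruent triangles make up the parallelogram on \<open>a\<close> and \<open>b\<close>, and either of its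
  diagonals may be used to cut it; this shows that \<open>S a b = F 0 a b\<close> equals
  \<open>S a (a + b)\<close>, the value for a triangle with the consecutive edges \<open>a\<close> and \<open>b\<close>.
  Cutting a quadrilateral with the consecutive edges \<open>a\<close>, \<open>b\<close>, \<open>c\<close> in two ways then makes \<open>S\<close> a
  2-cocycle on the additive group of the lattice, and an alternating 2-cocycle with values in the
  reals is bilinear.
\<close>
lemma lattice_triangle_functional:
  fixes F :: "complex \<Rightarrow> complex \<Rightarrow> complex \<Rightarrow> real"
  assumes trans: "\<And>a b c t. t \<in> lattice \<Longrightarrow> F (a + t) (b + t) (c + t) = F a b c"
    and refl: "\<And>a b c. F (- a) (- b) (- c) = F a b c"
    and swap: "\<And>a b c. F b a c = - F a b c"
    and rotate: "\<And>a b c. F b c a = F a b c"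
    and cocycle: "\<And>a b c d. F a b c + F a c d = F a b d + F b c d"
    and ab: "a \<in> lattice" "b \<in> lattice"
  shows "F 0 a b = (Re a * Im b - Im a * Re b) * F 0 1 \<i>"
proof -
  define S where "S = F 0"
  have S_swap: "S b a = - S a b" for a b
    unfolding S_def by (metis rotate swap)
  have reflect: "F (t - a) (t - b) (t - c) = F a b c" if "t \<in> lattice" for a b c t
    using trans [OF that, of "- a" "- b" "- c"] refl by simp
  have halves: "S a (a + b) = S a b" if "a \<in> lattice" "b \<in> lattice" for a b
  proof -
    have "F 0 a (a + b) + F 0 (a + b) b = F 0 a b + F a (a + b) b" by (rule cocycle)
    moreover have "F 0 (a + b) b = F 0 a (a + b)"
      using reflect [of "a + b" 0 a "a + b"] that rotate by simp
    moreover have "F a (a + b) b = F 0 a b"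
      using reflect [of "a + b" 0 a b] that by (metis add_diff_cancel_left' add_diff_cancel_right' diff_zero lattice_add rotate)
    ultimately show ?thesis unfolding S_def by linarith
  qed
  have two_cocycle: "S a b + S (a + b) c = S a (b + c) + S b c"
    if "a \<in> lattice" "b \<in> lattice" "c \<in> lattice" for a b c
  proof -
    have "F a (a + b) (a + (b + c)) = F 0 b (b + c)"
      using trans [of a 0 b "b + c"] that by (simp add: add.commute)
    then show ?thesis
      using cocycle [of 0 a "a + b" "a + (b + c)"] that halves [of a b] halves [of "a + b" c] halves [of a "b + c"]
        halves [of b c]
      by (simp add: S_def add.assoc)
  qed
  \<comment> \<open>The 2-cocycle identities for these three orders combine to twice the claim.\<close>
  have add_left: "S (a + b) c = S a c + S b c"
    if "a \<in> lattice" "b \<in> lattice" "c \<in> lattice" for a b c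
    using two_cocycle [of a b c] two_cocycle [of a c b] two_cocycle [of c a b] that
      S_swap [of a c] S_swap [of b c] S_swap [of c "a + b"]
    by (simp add: add.commute)
  have add_right: "S c (a + b) = S c a + S c b"
    if "a \<in> lattice" "b \<in> lattice" "c \<in> lattice" for a b c
    using add_left [OF that] S_swap by (metis minus_add_distrib)
  have S_same: "S a a = 0" for a
    using S_swap [of a a] by simp
  have "S a b = Re a * S 1 b + Im a * S \<i> b"
    by (rule additive_on_lattice [where f = "\<lambda>a. S a b"]) (use ab add_left in auto)
  moreover have "S 1 b = Im b * S 1 \<i>"
    using additive_on_lattice [of "S 1" b] ab add_right S_same by simp
  moreover have "S \<i> b = Re b * S \<i> 1"
    using additive_on_lattice [of "S \<i>" b] ab add_right S_same by simp
  moreover have "S \<i> 1 = - S 1 \<i>" by (rule S_swap)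
  ultimately show ?thesis
    by (simp add: S_def algebra_simps)
qed

section \<open>Lattice sum and integral for a triangle\<close>

definition triangle_winding :: "complex \<Rightarrow> complex \<Rightarrow> complex \<Rightarrow> complex \<Rightarrow> real" where
  "triangle_winding z a b c = turn z a b + turn z b c + turn z c a"

lemma triangle_winding_eq:
  assumes "z \<notin> closed_segment a b" "z \<notin> closed_segment b c" "z \<notin> closed_segment c a"
  shows "Re (winding_number (linepath a b +++ linepath b c +++ linepath c a) z) = triangle_winding z a b c"
  using assms
  by (simp add: winding_number_join path_image_join triangle_winding_def Re_winding_number_linepath)

lemma triangle_winding_outside:
  assumes "z \<notin> convex hull {a, b, c}"
  shows "triangle_winding z a b c = 0"
proof -
  let ?H = "convex hull {a, b, c}"
  have "closed_segment x y \<subseteq> ?H" if "{x, y} \<subseteq> {a, b, c}" for x y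
    using that by (intro closed_segment_subset) (auto simp: hull_inc)
  then have seg: "closed_segment a b \<subseteq> ?H" "closed_segment b c \<subseteq> ?H" "closed_segment c a \<subseteq> ?H"
    by simp_all
  then have "winding_number (linepath a b +++ linepath b c +++ linepath c a) z = 0"
    using assms
    by (intro winding_number_zero_outside [where s = ?H]) (auto simp: path_image_join convex_convex_hull)
  moreover have "z \<notin> closed_segment a b" "z \<notin> closed_segment b c" "z \<notin> closed_segment c a"
    using seg assms by blast+
  ultimately show ?thesis
    using triangle_winding_eq [of z a b c] by simp
qed

lemma triangle_winding_swap: "triangle_winding z b a c = - triangle_winding z a b c"
  unfolding triangle_winding_def
  using turn_swap [of z a b] turn_swap [of z a c] turn_swap [of z b c] by linarith

lemma triangle_winding_rotate: "triangle_winding z b c a = triangle_winding z a b c"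
  unfolding triangle_winding_def by simp

text \<open>The contributions of the cut along either diagonal cancel, by antisymmetry.\<close>
lemma triangle_winding_cocycle:
  "triangle_winding z a b c + triangle_winding z a c d = triangle_winding z a b d + triangle_winding z b c d"
  unfolding triangle_winding_def
  using turn_swap [of z a c] turn_swap [of z b d] by linarith

lemma triangle_winding_translation:
  "triangle_winding (z + t) (a + t) (b + t) (c + t) = triangle_winding z a b c"
  by (simp add: triangle_winding_def turn_translation)

lemma triangle_winding_uminus:
  "triangle_winding (- z) (- a) (- b) (- c) = triangle_winding z a b c"
  by (simp add: triangle_winding_def turn_uminus)

lemma borel_measurable_triangle_winding [measurable]:
  "(\<lambda>z. triangle_winding z a b c) \<in> borel_measurable borel"
  unfolding triangle_winding_def by measurable

lemma bounded_triangle: "bounded (convex hull {a, b, c :: complex})"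
  by (simp add: bounded_convex_hull finite_imp_bounded)

lemma summable_triangle_winding: "(\<lambda>u. triangle_winding u a b c) summable_on lattice"
proof (rule finite_nonzero_values_imp_summable_on)
  have "{u \<in> lattice. triangle_winding u a b c \<noteq> 0} \<subseteq> convex hull {a, b, c} \<inter> lattice"
    using triangle_winding_outside by blast
  then show "finite {u \<in> lattice. triangle_winding u a b c \<noteq> 0}"
    using finite_bounded_lattice [OF bounded_triangle] finite_subset by blast
qed

lemma integrable_triangle_winding: "integrable lborel (\<lambda>z. triangle_winding z a b c)"
proof (rule Bochner_Integration.integrable_bound)
  let ?H = "convex hull {a, b, c}"
  have H: "compact ?H"
    by (simp add: compact_convex_hull)
  then have "emeasure lborel ?H < \<infinity>"
    by (intro emeasure_bounded_finite compact_imp_bounded)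
  with H show "integrable lborel (\<lambda>z. 3 * indicator ?H z :: real)"
    by (auto intro!: integrable_real_indicator simp: compact_imp_closed borel_closed)
  show "AE z in lborel. norm (triangle_winding z a b c) \<le> norm (3 * indicator ?H z :: real)"
  proof (rule AE_I2)
    fix z
    have "\<bar>triangle_winding z a b c\<bar> \<le> 3"
      unfolding triangle_winding_def
      using abs_turn_le [of z a b] abs_turn_le [of z b c] abs_turn_le [of z c a] by linarith
    then show "norm (triangle_winding z a b c) \<le> norm (3 * indicator ?H z :: real)"
      by (cases "z \<in> ?H") (simp_all add: triangle_winding_outside)
  qed
qed simp

text \<open>
  These bounds determine the lattice points of the standard triangle, and the orientation of the
  loop as seen from its interior.
\<close>
lemma unit_triangle_bounds:
  assumes "z \<in> convex hull {0, 1, \<i>}"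
  shows "0 \<le> Re z" "0 \<le> Im z" "Re z + Im z \<le> 1"
proof -
  let ?T = "{z. 0 \<le> Re z} \<inter> {z. 0 \<le> Im z} \<inter> {z. (1 + \<i>) \<bullet> z \<le> 1}"
  have "convex hull {0, 1, \<i>} \<subseteq> ?T"
    by (rule hull_minimal)
       (auto intro!: convex_Int convex_halfspace_le convex_halfspace_Re_ge convex_halfspace_Im_ge)
  then show "0 \<le> Re z" "0 \<le> Im z" "Re z + Im z \<le> 1"
    using assms by (auto simp: inner_complex_def)
qed

lemma Arg_one_plus_ii: "Arg (1 + \<i>) = pi / 4"
  by (rule Arg_unique' [of "sqrt 2"]) (auto simp: complex_eq_iff cos_45 sin_45)

lemma infsum_triangle_winding_unit:
  "(\<Sum>\<^sub>\<infinity>u\<in>lattice. triangle_winding u 0 1 \<i>) = 1 / 2"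
proof -
  have hull: "u \<in> {0, 1, \<i>}" if u: "u \<in> convex hull {0, 1, \<i>}" "u \<in> lattice" for u
  proof -
    obtain x y where xy: "Re u = of_int x" "Im u = of_int y"
      using u(2) by (auto simp: lattice_def elim!: Ints_cases)
    have "0 \<le> x" "0 \<le> y" "x + y \<le> 1"
      using unit_triangle_bounds [OF u(1)] unfolding xy by linarith+
    then have "x = 0 \<and> y = 0 \<or> x = 1 \<and> y = 0 \<or> x = 0 \<and> y = 1" by linarith
    then show ?thesis using xy by (auto simp: complex_eq_iff)
  qed
  have "(\<Sum>\<^sub>\<infinity>u\<in>lattice. triangle_winding u 0 1 \<i>) = (\<Sum>\<^sub>\<infinity>u\<in>{0, 1, \<i>}. triangle_winding u 0 1 \<i>)"
    by (rule infsum_cong_neutral) (use hull in \<open>auto intro: triangle_winding_outside\<close>)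
  also have "\<dots> = triangle_winding 0 0 1 \<i> + triangle_winding 1 0 1 \<i> + triangle_winding \<i> 0 1 \<i>"
    by simp
  also have "triangle_winding 0 0 1 \<i> = 1 / 4"
  proof -
    have "0 \<notin> closed_segment 1 \<i>"
      unfolding in_closed_segment_iff_ratio by (simp add: complex_nonpos_Reals_iff)
    then show ?thesis by (simp add: triangle_winding_def turn_def)
  qed
  also have "triangle_winding 1 0 1 \<i> = 1 / 8"
  proof -
    have ratio: "(0 - 1) / (\<i> - 1) = of_real (1 / 2) * (1 + \<i>)"
      by (simp add: complex_eq_iff Re_divide Im_divide)
    have "1 \<notin> closed_segment \<i> 0"
      unfolding in_closed_segment_iff_ratio ratio by (simp add: complex_nonpos_Reals_iff)
    moreover have "Arg ((0 - 1) / (\<i> - 1)) = pi / 4"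
      unfolding ratio by (subst Arg_times_of_real) (simp_all add: Arg_one_plus_ii)
    ultimately show ?thesis
      by (simp add: triangle_winding_def turn_def)
  qed
  also have "triangle_winding \<i> 0 1 \<i> = 1 / 8"
  proof -
    have ratio: "(1 - \<i>) / (0 - \<i>) = 1 + \<i>"
      by (simp add: complex_eq_iff Re_divide Im_divide)
    have "\<i> \<notin> closed_segment 0 1"
      unfolding in_closed_segment_iff_ratio ratio by (simp add: complex_nonpos_Reals_iff)
    then have "triangle_winding \<i> 0 1 \<i> = Arg ((1 - \<i>) / (0 - \<i>)) / (2 * pi)"
      by (simp add: triangle_winding_def turn_def)
    then show ?thesis
      by (simp only: ratio Arg_one_plus_ii) simp
  qed
  finally show ?thesis by simp
qed

lemma integral_triangle_winding_unit:
  "(LINT z|lborel. triangle_winding z 0 1 \<i>) = 1 / 2"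
proof -
  let ?H = "convex hull {0, 1, \<i>}"
  have inside: "triangle_winding z 0 1 \<i> = 1" if z: "z \<in> interior ?H" for z
  proof -
    have seg: "z \<notin> closed_segment 0 1" "z \<notin> closed_segment 1 \<i>" "z \<notin> closed_segment \<i> 0"
      using z interior_of_triangle [of 0 1 \<i>] by (auto simp: closed_segment_def)
    then have "triangle_winding z 0 1 \<i> = Re (winding_number (linepath 0 1 +++ linepath 1 \<i> +++ linepath \<i> 0) z)"
      by (rule triangle_winding_eq [symmetric])
    also have "\<dots> = Re (if 0 < Im z then 1 else - 1)"
      by (subst winding_number_triangle [OF z]) simp
    also have "\<dots> = 1"
    proof -
      have b: "0 \<le> Re z" "0 \<le> Im z" "Re z + Im z \<le> 1"
        using z interior_subset unit_triangle_bounds by blast+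
      have "Im z \<noteq> 0"
      proof
        assume "Im z = 0"
        then have "z = (1 - Re z) *\<^sub>R 0 + Re z *\<^sub>R 1" by (simp add: complex_eq_iff)
        then have "z \<in> closed_segment 0 1"
          using b unfolding in_segment by (intro exI [of _ "Re z"]) auto
        with seg show False by simp
      qed
      with b show ?thesis by simp
    qed
    finally show ?thesis .
  qed
  have "AE z in lborel. z \<notin> frontier ?H"
  proof (rule AE_not_in, rule null_setsI)
    have "negligible (frontier ?H)"
      by (simp add: negligible_convex_frontier convex_convex_hull)
    then show "emeasure lborel (frontier ?H) = 0"
      by (auto simp: negligible_iff_null_sets dest!: null_setsD1)
  qed simp
  then have "AE z in lborel. z \<in> interior ?H \<or> z \<notin> ?H"
    by eventually_elim (use closure_subset in \<open>auto simp: frontier_def\<close>)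
  then have "AE z in lborel. triangle_winding z 0 1 \<i> = indicator ?H z"
  proof eventually_elim
    case (elim z)
    then show ?case
      using inside [of z] interior_subset [of ?H] by (auto simp: triangle_winding_outside)
  qed
  then have "(LINT z|lborel. triangle_winding z 0 1 \<i>) = (LINT z|lborel. indicator ?H z)"
    by (intro integral_cong_AE) (auto simp: borel_closed compact_imp_closed compact_convex_hull)
  also have "\<dots> = measure lborel ?H" by simp
  also have "\<dots> = 1 / 2"
    using content_std_simplex [where 'a = complex] by (simp add: Basis_complex_def)
  finally show ?thesis .
qed

text \<open>
  Both sides satisfy the hypotheses of \<open>lattice_triangle_functional\<close> and agree on the standard
  triangle.
\<close>
lemma infsum_triangle_winding_eq_integral:
  assumes "a \<in> lattice" "b \<in> lattice"
  shows "(\<Sum>\<^sub>\<infinity>u\<in>lattice. triangle_winding u 0 a b) = (LINT z|lborel. triangle_winding z 0 a b)"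
proof -
  let ?S = "\<lambda>a b c. \<Sum>\<^sub>\<infinity>u\<in>lattice. triangle_winding u a b c"
  let ?I = "\<lambda>a b c. LINT z|lborel. triangle_winding z a b c"
  have "?S 0 a b = (Re a * Im b - Im a * Re b) * ?S 0 1 \<i>"
  proof (rule lattice_triangle_functional [where F = ?S])
    fix a b c d
    show "?S (a + t) (b + t) (c + t) = ?S a b c" if t: "t \<in> lattice" for t
    proof -
      have "(\<Sum>\<^sub>\<infinity>u\<in>lattice. triangle_winding (u + t) (a + t) (b + t) (c + t)) = ?S (a + t) (b + t) (c + t)"
        by (rule infsum_reindex_bij_betw, rule bij_betw_byWitness [where f' = "\<lambda>u. u - t"]) (use t in auto)
      then show ?thesis by (simp add: triangle_winding_translation)
    qed
    have "(\<Sum>\<^sub>\<infinity>u\<in>lattice. triangle_winding (- u) (- a) (- b) (- c)) = ?S (- a) (- b) (- c)"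
      by (rule infsum_reindex_bij_betw, rule bij_betw_byWitness [where f' = uminus]) auto
    then show "?S (- a) (- b) (- c) = ?S a b c" by (simp add: triangle_winding_uminus)
    show "?S b a c = - ?S a b c"
      by (subst triangle_winding_swap) (simp add: infsum_uminus)
    show "?S b c a = ?S a b c"
      by (subst triangle_winding_rotate) simp
    show "?S a b c + ?S a c d = ?S a b d + ?S b c d"
      using triangle_winding_cocycle [of _ a b c d]
      by (subst (1 2) infsum_add [symmetric]) (simp_all add: summable_triangle_winding)
  qed (use assms in auto)
  moreover have "?I 0 a b = (Re a * Im b - Im a * Re b) * ?I 0 1 \<i>"
  proof (rule lattice_triangle_functional [where F = ?I])
    fix a b c d
    show "?I (a + t) (b + t) (c + t) = ?I a b c" for t
    proof -
      have "?I (a + t) (b + t) (c + t) = (LINT z|distr lborel borel ((+) t). triangle_winding z (a + t) (b + t) (c + t))"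
        by (simp add: lborel_distr_plus)
      also have "\<dots> = ?I a b c"
        by (subst integral_distr) (simp_all add: triangle_winding_translation add.commute [of t])
      finally show ?thesis .
    qed
    have "(lborel :: complex measure) = distr lborel borel uminus"
      using lborel_affine [of "- 1" "0 :: complex"] by (simp add: density_1)
    then have "?I (- a) (- b) (- c) = (LINT z|distr lborel borel uminus. triangle_winding z (- a) (- b) (- c))"
      by simp
    also have "\<dots> = ?I a b c"
      by (subst integral_distr) (simp_all add: triangle_winding_uminus)
    finally show "?I (- a) (- b) (- c) = ?I a b c" .
    show "?I b a c = - ?I a b c"
      by (subst triangle_winding_swap) simp
    show "?I b c a = ?I a b c"
      by (subst triangle_winding_rotate) simp
    show "?I a b c + ?I a c d = ?I a b d + ?I b c d"
      unfolding Bochner_Integration.integral_add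
        [OF integrable_triangle_winding integrable_triangle_winding, symmetric]
      by (rule Bochner_Integration.integral_cong [OF HOL.refl triangle_winding_cocycle])
  qed (use assms in auto)
  ultimately show ?thesis
    by (simp add: infsum_triangle_winding_unit integral_triangle_winding_unit)
qed

section \<open>The area as a sum over lattice points\<close>

lemma cyc_add_length [simp]: "cyc xs (i + length xs) = cyc xs i"
  by (simp add: cyc_def)

text \<open>
  The sides from \<open>0\<close> to the vertices are traversed once in each direction, so they cancel. As
  \<open>turn\<close> is antisymmetric on the segments too, this holds for all \<open>z\<close>, including the lattice
  points on the auxiliary sides.
\<close>
lemma pv_winding_eq_triangles:
  "pv_winding vs z = (\<Sum>i<length vs. triangle_winding z 0 (cyc vs i) (cyc vs (i + 1)))"
proof -
  have "(\<Sum>i<length vs. turn z 0 (cyc vs i) - turn z 0 (cyc vs (i + 1))) = 0"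
    using sum_lessThan_telescope' [of "\<lambda>i. turn z 0 (cyc vs i)" "length vs"] cyc_add_length [of vs 0]
    by simp
  moreover have "triangle_winding z 0 a b = turn z a b + (turn z 0 a - turn z 0 b)" for a b
    using turn_swap [of z 0 b] by (simp add: triangle_winding_def)
  ultimately show ?thesis
    by (simp add: pv_winding_def sum.distrib)
qed

lemma AE_not_in_sides: "AE z in lborel. z \<notin> (\<Union>i<n. side vs i)"
proof -
  have "AE z in lborel. z \<notin> side vs i" for i
  proof (rule AE_not_in, rule null_setsI)
    have "negligible (side vs i)"
      by (simp add: side_def negligible_convex_interior interior_closed_segment)
    then show "emeasure lborel (side vs i) = 0"
      by (auto simp: negligible_iff_null_sets side_def dest!: null_setsD1)
  qed (simp add: side_def)
  then have "AE z in lborel. \<forall>i\<in>{..<n}. z \<notin> side vs i"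
    by (intro AE_finite_allI) auto
  then show ?thesis by eventually_elim auto
qed

lemma infsum_finite_sum:
  fixes f :: "'i \<Rightarrow> 'a \<Rightarrow> real"
  assumes "finite I" "\<And>i. i \<in> I \<Longrightarrow> f i summable_on A"
  shows "(\<Sum>\<^sub>\<infinity>x\<in>A. \<Sum>i\<in>I. f i x) = (\<Sum>i\<in>I. \<Sum>\<^sub>\<infinity>x\<in>A. f i x)"
proof (rule infsumI)
  show "((\<lambda>x. \<Sum>i\<in>I. f i x) has_sum (\<Sum>i\<in>I. infsum (f i) A)) A"
    using assms by (induction I rule: finite_induct) (auto intro!: has_sum_add)
qed

lemma A_term_eq_infsum_pv_winding:
  assumes "vs \<noteq> []" "set vs \<subseteq> lattice"
  shows "A_term vs = (\<Sum>\<^sub>\<infinity>u\<in>lattice. pv_winding vs u)"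
proof -
  let ?U = "\<Union>i<length vs. side vs i"
  let ?t = "\<lambda>i z. triangle_winding z 0 (cyc vs i) (cyc vs (i + 1))"
  have latt: "cyc vs i \<in> lattice" for i
    using assms by (auto simp: cyc_def subset_iff)
  have "closed ?U"
    by (intro closed_UN) (auto simp: side_def)
  then have U: "- ?U \<in> sets borel" by (intro borel_open open_Compl)
  have pv [measurable]: "pv_winding vs \<in> borel_measurable borel"
    unfolding pv_winding_def by measurable
  have "A_term vs = (LINT z|lborel. indicator (- ?U) z *\<^sub>R pv_winding vs z)"
    unfolding A_term_def set_lebesgue_integral_def
  proof (intro Bochner_Integration.integral_cong)
    show "indicator (- ?U) z *\<^sub>R loop_winding vs z = indicator (- ?U) z *\<^sub>R pv_winding vs z" for z
      by (cases "z \<in> ?U") (use assms loop_winding_eq_pv_winding in \<open>simp_all del: UN_iff\<close>)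
  qed simp
  also have "\<dots> = (LINT z|lborel. pv_winding vs z)"
  proof (rule integral_cong_AE)
    show "AE z in lborel. indicator (- ?U) z *\<^sub>R pv_winding vs z = pv_winding vs z"
      using AE_not_in_sides [where vs = vs and n = "length vs"] by eventually_elim auto
  qed (intro borel_measurable_scaleR borel_measurable_indicator,
      simp_all only: sets_lborel measurable_lborel1 measurable_lborel2 U pv)
  also have "\<dots> = (\<Sum>i<length vs. LINT z|lborel. ?t i z)"
    unfolding pv_winding_eq_triangles
    by (rule Bochner_Integration.integral_sum) (rule integrable_triangle_winding)
  also have "\<dots> = (\<Sum>i<length vs. \<Sum>\<^sub>\<infinity>u\<in>lattice. ?t i u)"
    by (simp add: infsum_triangle_winding_eq_integral latt)
  also have "\<dots> = (\<Sum>\<^sub>\<infinity>u\<in>lattice. pv_winding vs u)"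
    unfolding pv_winding_eq_triangles
    by (rule infsum_finite_sum [symmetric]) (simp_all add: summable_triangle_winding)
  finally show ?thesis .
qed

section \<open>Angles subtended by a moving segment\<close>

lemma Arg_mult_Re_pos:
  assumes "Re x > 0" "Re y > 0"
  shows "Arg (x * y) = Arg x + Arg y" "\<bar>Arg x + Arg y\<bar> < pi"
proof -
  have "\<bar>Arg x\<bar> < pi / 2" "\<bar>Arg y\<bar> < pi / 2"
    using assms Arg_Re_pos by blast+
  then show *: "\<bar>Arg x + Arg y\<bar> < pi" by linarith
  show "Arg (x * y) = Arg x + Arg y"
    by (rule Arg_times) (use * assms in auto)
qed

lemma Re_inverse_pos_iff: "Re (inverse z) > 0 \<longleftrightarrow> Re z > 0"
  by (simp add: zero_less_divide_iff power2_eq_square sum_squares_gt_zero_iff not_sum_squares_lt_zero) auto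

lemma Re_divide_eq_inner:
  assumes "norm n = 1"
  shows "Re (x / n) = x \<bullet> n"
  using assms by (simp add: Re_complex_div_eq_0 Re_divide inner_complex_def cmod_def)

lemma tendsto_turn_off_segment:
  assumes u: "u \<notin> closed_segment a b"
    and A: "(A \<longlongrightarrow> a) F" and B: "(B \<longlongrightarrow> b) F"
  shows "((\<lambda>x. turn u (A x) (B x)) \<longlongrightarrow> turn u a b) F"
    and "\<forall>\<^sub>F x in F. u \<notin> closed_segment (A x) (B x)"
proof -
  have au: "a - u \<noteq> 0" using u by auto
  have r: "(b - u) / (a - u) \<notin> \<real>\<^sub>\<le>\<^sub>0"
    using u by (simp add: in_closed_segment_iff_ratio)
  have lim: "((\<lambda>x. (B x - u) / (A x - u)) \<longlongrightarrow> (b - u) / (a - u)) F"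
    by (intro tendsto_intros A B au)
  have "open (- \<real>\<^sub>\<le>\<^sub>0 :: complex set)" by (simp add: open_Compl)
  then have "\<forall>\<^sub>F x in F. (B x - u) / (A x - u) \<in> - \<real>\<^sub>\<le>\<^sub>0"
    using topological_tendstoD [OF lim] r by blast
  then show ev: "\<forall>\<^sub>F x in F. u \<notin> closed_segment (A x) (B x)"
    by (simp add: in_closed_segment_iff_ratio)
  have "((\<lambda>x. Arg ((B x - u) / (A x - u)) / (2 * pi)) \<longlongrightarrow> Arg ((b - u) / (a - u)) / (2 * pi)) F"
    by (intro tendsto_intros lim r) auto
  moreover have "\<forall>\<^sub>F x in F. Arg ((B x - u) / (A x - u)) / (2 * pi) = turn u (A x) (B x)"
    using ev by eventually_elim (simp add: turn_def)
  ultimately show "((\<lambda>x. turn u (A x) (B x)) \<longlongrightarrow> turn u a b) F"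
    using u by (auto simp: turn_def [of u a b] elim: Lim_transform_eventually)
qed

lemma Arg_imaginary:
  fixes e s :: real
  assumes "e = 1 \<or> e = - 1" "s > 0"
  shows "Arg (of_real s * (\<i> * of_real e)) = e * pi / 2"
  using assms Arg_minus [of \<i>] by (subst Arg_times_of_real) auto

text \<open>
  The points of the side differ from \<open>u\<close> by real multiples of \<open>\<i> * n\<close>, so after pushing, both
  endpoints lie in the open half plane around \<open>n\<close> as seen from \<open>u\<close>. Hence the pushed side misses
  \<open>u\<close>, and the subtended angle is the sum of the angle from the first endpoint to \<open>n\<close> and the one
  from \<open>n\<close> to the second endpoint, both in \<open>(- pi / 2, pi / 2)\<close>. Each of these two angles is
  constant if its endpoint comes from \<open>u\<close>; otherwise it tends to a right angle with sign \<open>e\<close>.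
\<close>
lemma tendsto_turn_pushed_side:
  fixes a b n p q u :: complex and e l :: real
  assumes n: "norm n = 1" and pn: "p \<bullet> n > 0" and qn: "q \<bullet> n > 0"
    and e: "e = 1 \<or> e = - 1" and l: "l > 0" and ab: "b - a = of_real l * (\<i> * of_real e * n)"
    and u: "u \<in> closed_segment a b"
  shows "((\<lambda>\<delta>. turn u (a + \<delta> *\<^sub>R p) (b + \<delta> *\<^sub>R q)) \<longlongrightarrow>
           ((if u = b then Arg (q / n) else e * pi / 2) +
            (if u = a then Arg (n / p) else e * pi / 2)) / (2 * pi)) (at_right 0)" (is ?lim)
    and "\<forall>\<^sub>F \<delta> in at_right 0. u \<notin> closed_segment (a + \<delta> *\<^sub>R p) (b + \<delta> *\<^sub>R q)" (is ?off)
proof -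
  obtain t where t: "0 \<le> t" "t \<le> 1" "u = (1 - t) *\<^sub>R a + t *\<^sub>R b"
    using u by (auto simp: in_segment)
  have n0: "n \<noteq> 0" using n by auto
  have ee: "e * e = 1" using e by auto
  have bu: "b - u = of_real ((1 - t) * l) * (\<i> * of_real e * n)"
  proof -
    have "b - u = of_real (1 - t) * (b - a)"
      by (simp add: t(3) scaleR_conv_of_real algebra_simps)
    then show ?thesis by (simp add: ab)
  qed
  have au: "a - u = - of_real (t * l) * (\<i> * of_real e * n)"
  proof -
    have "a - u = - of_real t * (b - a)"
      by (simp add: t(3) scaleR_conv_of_real algebra_simps)
    then show ?thesis by (simp add: ab)
  qed
  \<comment> \<open>The arguments of \<open>X\<close> and \<open>Y\<close> are the angles from \<open>n\<close> to the second endpoint and from the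
    first endpoint to \<open>n\<close>.\<close>
  define X where "X \<delta> = (b + \<delta> *\<^sub>R q - u) / n" for \<delta>
  define Y where "Y \<delta> = n / (a + \<delta> *\<^sub>R p - u)" for \<delta>
  have XY: "Re (X \<delta>) > 0" "Re (Y \<delta>) > 0" if \<delta>: "\<delta> > 0" for \<delta>
  proof -
    have "X \<delta> = of_real ((1 - t) * l * e) * \<i> + of_real \<delta> * (q / n)"
      using n0 bu by (simp add: X_def field_simps scaleR_conv_of_real)
    then show "Re (X \<delta>) > 0"
      using \<delta> qn n by (simp add: Re_divide_eq_inner del: times_divide_eq_right)
    have "inverse (Y \<delta>) = - of_real (t * l * e) * \<i> + of_real \<delta> * (p / n)"
      using n0 au by (simp add: Y_def field_simps scaleR_conv_of_real)
    then have "Re (inverse (Y \<delta>)) > 0"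
      using \<delta> pn n by (simp add: Re_divide_eq_inner del: times_divide_eq_right)
    then show "Re (Y \<delta>) > 0"
      by (simp only: Re_inverse_pos_iff)
  qed
  have pos: "\<forall>\<^sub>F \<delta> in at_right 0. \<delta> > (0::real)"
    by (rule eventually_at_right_less)
  have ratio: "(b + \<delta> *\<^sub>R q - u) / (a + \<delta> *\<^sub>R p - u) = X \<delta> * Y \<delta>" for \<delta>
    using n0 by (simp add: X_def Y_def)
  have off: "u \<notin> closed_segment (a + \<delta> *\<^sub>R p) (b + \<delta> *\<^sub>R q)" if "\<delta> > 0" for \<delta>
  proof -
    have "X \<delta> * Y \<delta> \<noteq> 0" using XY [OF that] by auto
    moreover have "Arg (X \<delta> * Y \<delta>) \<noteq> pi"
      using Arg_mult_Re_pos [OF XY [OF that]] by auto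
    ultimately have "X \<delta> * Y \<delta> \<notin> \<real>\<^sub>\<le>\<^sub>0"
      unfolding Arg_eq_pi complex_nonpos_Reals_iff complex_eq_iff by auto
    then show ?thesis
      by (simp add: in_closed_segment_iff_ratio ratio)
  qed
  then show ?off
    using pos by (auto elim: eventually_mono)
  have turn_eq: "turn u (a + \<delta> *\<^sub>R p) (b + \<delta> *\<^sub>R q) = (Arg (X \<delta>) + Arg (Y \<delta>)) / (2 * pi)"
    if "\<delta> > 0" for \<delta>
    using off [OF that] Arg_mult_Re_pos [OF XY [OF that]] by (simp add: turn_def ratio)
  have limX: "((\<lambda>\<delta>. Arg (X \<delta>)) \<longlongrightarrow> (if u = b then Arg (q / n) else e * pi / 2)) (at_right 0)"
  proof (cases "u = b")
    case True
    have "\<forall>\<^sub>F \<delta> in at_right 0. Arg (q / n) = Arg (X \<delta>)"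
      using pos by eventually_elim (simp add: X_def True scaleR_conv_of_real flip: times_divide_eq_right)
    then show ?thesis
      using True by (auto intro: Lim_transform_eventually [OF tendsto_const])
  next
    case False
    then have "t \<noteq> 1" using t(3) by auto
    then have s: "(1 - t) * l > 0" using t l by simp
    have lim0: "(X \<longlongrightarrow> (b + 0 *\<^sub>R q - u) / n) (at_right 0)"
      unfolding X_def by (intro tendsto_intros n0)
    have X0: "(b + 0 *\<^sub>R q - u) / n = of_real ((1 - t) * l) * (\<i> * of_real e)"
      using n0 by (simp add: bu)
    have "((\<lambda>\<delta>. Arg (X \<delta>)) \<longlongrightarrow> Arg (of_real ((1 - t) * l) * (\<i> * of_real e))) (at_right 0)"
      by (intro tendsto_Arg lim0 [unfolded X0]) (use s e in \<open>auto simp: complex_nonpos_Reals_iff\<close>)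
    then show ?thesis
      using False by (simp only: Arg_imaginary [OF e s] if_False)
  qed
  have limY: "((\<lambda>\<delta>. Arg (Y \<delta>)) \<longlongrightarrow> (if u = a then Arg (n / p) else e * pi / 2)) (at_right 0)"
  proof (cases "u = a")
    case True
    have "\<forall>\<^sub>F \<delta> in at_right 0. Arg (n / p) = Arg (Y \<delta>)"
      using pos
    proof eventually_elim
      case (elim \<delta>)
      have "Y \<delta> = of_real (1 / \<delta>) * (n / p)"
        by (simp add: Y_def True scaleR_conv_of_real)
      then show ?case using elim by (simp only: Arg_times_of_real zero_less_divide_1_iff)
    qed
    then show ?thesis
      using True by (auto intro: Lim_transform_eventually [OF tendsto_const])
  next
    case False
    then have "t \<noteq> 0" using t(3) by auto
    then have s: "1 / (t * l) > 0" using t l by simp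
    have lim0: "(Y \<longlongrightarrow> n / (a + 0 *\<^sub>R p - u)) (at_right 0)"
      unfolding Y_def using False by (intro tendsto_intros) auto
    have "of_real e * of_real e = (1 :: complex)"
      using ee by (metis of_real_1 of_real_mult)
    then have Y0: "n / (a + 0 *\<^sub>R p - u) = of_real (1 / (t * l)) * (\<i> * of_real e)"
      using n0 \<open>t \<noteq> 0\<close> l e by (auto simp: au field_simps)
    have "((\<lambda>\<delta>. Arg (Y \<delta>)) \<longlongrightarrow> Arg (of_real (1 / (t * l)) * (\<i> * of_real e))) (at_right 0)"
      by (intro tendsto_Arg lim0 [unfolded Y0]) (use s e in \<open>auto simp: complex_nonpos_Reals_iff\<close>)
    then show ?thesis
      using False by (simp only: Arg_imaginary [OF e s] if_False)
  qed
  have "((\<lambda>\<delta>. (Arg (X \<delta>) + Arg (Y \<delta>)) / (2 * pi)) \<longlongrightarrow>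
           ((if u = b then Arg (q / n) else e * pi / 2) +
            (if u = a then Arg (n / p) else e * pi / 2)) / (2 * pi)) (at_right 0)"
    by (intro tendsto_divide tendsto_add limX limY tendsto_const) simp
  then show ?lim
    by (rule Lim_transform_eventually) (use pos in eventually_elim, simp add: turn_eq)
qed

text \<open>The integers are closed and discrete.\<close>
lemma eventually_eq_limit_if_Ints:
  fixes f :: "'a \<Rightarrow> real"
  assumes lim: "(f \<longlongrightarrow> L) F" and Ints: "\<forall>\<^sub>F x in F. f x \<in> \<int>"
  shows "\<forall>\<^sub>F x in F. f x = L"
proof (cases "F = bot")
  case False
  have L: "L \<in> \<int>"
    by (rule Lim_in_closed_set [OF closed_Ints Ints False lim])
  have "\<forall>\<^sub>F x in F. dist (f x) L < 1"
    using lim by (rule tendstoD) simp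
  with Ints show ?thesis
    by eventually_elim (use L in \<open>simp add: dist_real_def Ints_eq_abs_less1\<close>)
qed auto

section \<open>Normals and pushed vertices of a multi-polygon\<close>

lemma inner_eq_0_imp_parallel:
  fixes x m :: complex
  assumes "x \<noteq> 0" "x \<bullet> m = 0"
  obtains c :: real where "m = of_real c * (\<i> * x)"
proof
  have "(norm x)\<^sup>2 \<noteq> 0" using assms by simp
  moreover have "Re x * Re m = - (Im x * Im m)"
    using assms by (simp add: inner_complex_def)
  ultimately show "m = of_real ((m \<bullet> (\<i> * x)) / (norm x)\<^sup>2) * (\<i> * x)"
    by (simp add: complex_eq_iff inner_complex_def cmod_power2 divide_simps) algebra
qed

text \<open>
  The vector \<open>p\<close> points along the bisector of \<open>m\<close> and \<open>n\<close>. The formula also covers \<open>m = n\<close>,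
  where it gives \<open>p = n\<close>.
\<close>
lemma miter_inner:
  fixes m n :: complex
  assumes m: "norm m = 1" and n: "norm n = 1" and opp: "m \<noteq> - n"
  defines "p \<equiv> (m + n) /\<^sub>R (1 + m \<bullet> n)"
  shows "p \<bullet> m = 1" "p \<bullet> n = 1"
proof -
  have mm: "m \<bullet> m = 1" and nn: "n \<bullet> n = 1"
    using m n by (simp_all add: dot_square_norm)
  have "m + n \<noteq> 0" using opp by (simp add: eq_neg_iff_add_eq_0)
  then have "(m + n) \<bullet> (m + n) > 0" by simp
  then have "1 + m \<bullet> n > 0"
    by (simp add: inner_add_left inner_add_right inner_commute [of n m] mm nn)
  then show "p \<bullet> m = 1" "p \<bullet> n = 1"
    by (simp_all add: p_def inner_add_left inner_commute [of n m] mm nn add.commute)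
qed

lemma collinear_0_scaleR: "collinear {0, s *\<^sub>R x, t *\<^sub>R x}"
proof (cases "s = 0")
  case False
  then have "t *\<^sub>R x = (t / s) *\<^sub>R (s *\<^sub>R x)" by simp
  then show ?thesis unfolding collinear_lemma by blast
qed (simp add: collinear_lemma)

lemma sum_cyclic_shift:
  fixes g :: "nat \<Rightarrow> 'a::ab_group_add"
  assumes "g d = g 0"
  shows "(\<Sum>i<d. g (i + 1)) = (\<Sum>i<d. g i)"
  using sum.lessThan_Suc_shift [of g d] sum.lessThan_Suc [of g d] assms by simp

locale multi_polygon =
  fixes vs :: "complex list" and es :: "int list"
  assumes lattice_multi_polygon: "lattice_multi_polygon vs es"
begin

abbreviation V :: "nat \<Rightarrow> complex" where "V \<equiv> cyc vs"
abbreviation N :: "nat \<Rightarrow> complex" where "N \<equiv> normal_vec vs es"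
abbreviation sgn_side :: "nat \<Rightarrow> real" where "sgn_side i \<equiv> of_int (cyc es i)"

text \<open>
  The velocity of vertex \<open>i\<close> when the sides are pushed with unit speed, by a formula that is valid
  both at a corner and at a vertex where the two sides lie on one line.
\<close>
definition miter :: "nat \<Rightarrow> complex" where
  "miter i = (let m = N (i + length vs - 1) in (m + N i) /\<^sub>R (1 + m \<bullet> N i))"

lemma nonempty: "vs \<noteq> []"
  and length_es: "length es = length vs"
  and vertices_lattice: "set vs \<subseteq> lattice"
  and V_neq: "V i \<noteq> V (i + 1)"
  using lattice_multi_polygon by (auto simp: lattice_multi_polygon_def)

lemma V_lattice: "V i \<in> lattice"
  using vertices_lattice nonempty by (auto simp: cyc_def)

lemma cyc_es_cases: "cyc es i = 1 \<or> cyc es i = - 1"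
proof -
  have "cyc es i \<in> set es" using nonempty length_es by (auto simp: cyc_def)
  then show ?thesis
    using lattice_multi_polygon by (auto simp: lattice_multi_polygon_def)
qed

lemma sgn_side_cases: "sgn_side i = 1 \<or> sgn_side i = - 1"
  using cyc_es_cases [of i] by auto

lemma cyc_es_add_length [simp]: "cyc es (i + length vs) = cyc es i"
  using cyc_add_length [of es i] by (simp add: length_es)

lemma N_add_length [simp]: "N (i + length vs) = N i"
  using cyc_add_length [of vs "i + 1"] by (simp add: normal_vec_def algebra_simps)

lemma norm_N [simp]: "norm (N i) = 1"
  using V_neq [of i] sgn_side_cases [of i] by (auto simp: normal_vec_def norm_sgn)

lemma side_vec: "V (i + 1) - V i = of_real (dist (V i) (V (i + 1))) * (\<i> * of_real (sgn_side i) * N i)"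
proof -
  let ?D = "V (i + 1) - V i" and ?l = "complex_of_real (dist (V i) (V (i + 1)))"
  have l: "?l \<noteq> 0" using V_neq [of i] by simp
  have "norm (- \<i> * of_int (cyc es i) * ?D) = dist (V i) (V (i + 1))"
    using cyc_es_cases [of i] by (auto simp: norm_mult dist_norm norm_minus_commute)
  then have "N i = - \<i> * of_int (cyc es i) * ?D / ?l"
    by (simp only: normal_vec_def sgn_eq)
  moreover have "of_int (cyc es i) * of_int (cyc es i) = (1 :: complex)"
    using cyc_es_cases [of i] by auto
  moreover have "D = l * (\<i> * E * n)" if "n = - \<i> * E * D / l" "E * E = 1" "l \<noteq> 0" for n E D l :: complex
    using that by (simp add: field_simps)
  ultimately show ?thesis
    using l by simp
qed

text \<open>
  This is where the two sign conditions enter: the sign changes at a collinear vertex exactly when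
  the direction of the loop is reversed.
\<close>
lemma N_eq_if_collinear:
  assumes "collinear {V i, V (i + 1), V (i + 2)}"
  shows "N (i + 1) = N i"
proof -
  let ?a = "V i" and ?b = "V (i + 1)" and ?c = "V (i + 2)"
  have ne: "?a \<noteq> ?b" "?b \<noteq> ?c" using V_neq [of i] V_neq [of "i + 1"] by simp_all
  have conds: "?b \<in> closed_segment ?a ?c \<Longrightarrow> cyc es i = cyc es (i + 1)"
     "?a \<in> closed_segment ?b ?c \<or> ?c \<in> closed_segment ?a ?b \<Longrightarrow> cyc es i \<noteq> cyc es (i + 1)"
    using lattice_multi_polygon assms
    by (auto simp: lattice_multi_polygon_def side_def)
  have "collinear {0, ?a - ?b, ?c - ?b}"
    using assms by (simp add: collinear_3)
  \<comment> \<open>The loop goes straight on if \<open>r < 0\<close> and turns back if \<open>r > 0\<close>.\<close>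
  then obtain r where r: "?c - ?b = r *\<^sub>R (?a - ?b)"
    using ne by (auto simp: collinear_lemma)
  then have c: "?c = ?b + r *\<^sub>R (?a - ?b)" by (simp add: algebra_simps)
  have next_vertex: "V (i + 1 + 1) = ?c" by simp
  have "r \<noteq> 0" using r ne by auto
  then consider "r < 0" | "0 < r" by linarith
  then show ?thesis
  proof cases
    case 1
    define u where "u = 1 / (1 - r)"
    have u: "0 \<le> u" "u \<le> 1" "u * (1 - r) = 1" using 1 by (auto simp: u_def)
    have "?b - ((1 - u) *\<^sub>R ?a + u *\<^sub>R ?c) = (1 - u * (1 - r)) *\<^sub>R (?b - ?a)"
      unfolding c by (simp add: algebra_simps)
    then have "?b \<in> closed_segment ?a ?c"
      using u by (auto simp: in_segment)
    then have e: "cyc es (i + 1) = cyc es i" using conds by simp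
    have "- \<i> * of_int (cyc es (i + 1)) * (?c - ?b) = (- r) *\<^sub>R (- \<i> * of_int (cyc es i) * (?b - ?a))"
      unfolding r e by (simp add: scaleR_conv_of_real algebra_simps)
    then have "N (i + 1) = sgn ((- r) *\<^sub>R (- \<i> * of_int (cyc es i) * (?b - ?a)))"
      by (simp only: normal_vec_def next_vertex)
    then show ?thesis
      using 1 by (simp only: sgn_scaleR) (simp add: normal_vec_def)
  next
    case 2
    have "?a \<in> closed_segment ?b ?c \<or> ?c \<in> closed_segment ?a ?b"
    proof (cases "r \<le> 1")
      case True
      have "?c = (1 - (1 - r)) *\<^sub>R ?a + (1 - r) *\<^sub>R ?b"
        unfolding c by (simp add: algebra_simps)
      then show ?thesis
        using 2 True unfolding in_segment by (intro disjI2 exI [of _ "1 - r"]) auto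
    next
      case False
      have "?a = (1 - 1 / r) *\<^sub>R ?b + (1 / r) *\<^sub>R ?c"
        unfolding c using 2 by (simp add: algebra_simps)
      then show ?thesis
        using 2 False unfolding in_segment by (intro disjI1 exI [of _ "1 / r"]) auto
    qed
    then have "cyc es i \<noteq> cyc es (i + 1)" using conds by simp
    then have e: "cyc es (i + 1) = - cyc es i"
      using cyc_es_cases [of i] cyc_es_cases [of "i + 1"] by auto
    have "- \<i> * of_int (cyc es (i + 1)) * (?c - ?b) = r *\<^sub>R (- \<i> * of_int (cyc es i) * (?b - ?a))"
      unfolding r e by (simp add: scaleR_conv_of_real algebra_simps)
    then have "N (i + 1) = sgn (r *\<^sub>R (- \<i> * of_int (cyc es i) * (?b - ?a)))"
      by (simp only: normal_vec_def next_vertex)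
    then show ?thesis
      using 2 by (simp only: sgn_scaleR) (simp add: normal_vec_def)
  qed
qed

lemma collinear_if_common_normal:
  assumes "x \<noteq> 0" "x \<bullet> N i = 0" "x \<bullet> N (i + 1) = 0"
  shows "collinear {V i, V (i + 1), V (i + 2)}"
proof -
  obtain c where c: "N i = of_real c * (\<i> * x)"
    using inner_eq_0_imp_parallel [OF assms(1,2)] .
  obtain d where d: "N (i + 1) = of_real d * (\<i> * x)"
    using inner_eq_0_imp_parallel [OF assms(1,3)] .
  have "V (i + 1) - V i = of_real (- dist (V i) (V (i + 1)) * sgn_side i * c) * x"
    unfolding side_vec c by (simp add: algebra_simps)
  moreover have "V (i + 2) - V (i + 1) = of_real (- dist (V (i + 1)) (V (i + 2)) * sgn_side (i + 1) * d) * x"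
    using side_vec [of "i + 1"] d by (simp add: algebra_simps)
  ultimately have "V i - V (i + 1) = (dist (V i) (V (i + 1)) * sgn_side i * c) *\<^sub>R x"
     "V (i + 2) - V (i + 1) = (- dist (V (i + 1)) (V (i + 2)) * sgn_side (i + 1) * d) *\<^sub>R x"
    by (simp_all add: scaleR_conv_of_real algebra_simps)
  then have "collinear {0, V i - V (i + 1), V (i + 2) - V (i + 1)}"
    by (simp only: collinear_0_scaleR)
  then show ?thesis using collinear_3 [of "V i" "V (i + 1)" "V (i + 2)"] by (simp only: NO_MATCH_def simp_thms)
qed

lemma N_not_opposite: "N i \<noteq> - N (i + 1)"
proof
  assume opp: "N i = - N (i + 1)"
  have N0: "N i \<noteq> 0" using norm_N [of i] by force
  have "(\<i> * N i) \<bullet> N i = 0" by (simp add: inner_complex_def)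
  then have "collinear {V i, V (i + 1), V (i + 2)}"
    using N0 opp by (intro collinear_if_common_normal [of "\<i> * N i"]) (simp_all add: inner_complex_def)
  then have "N (i + 1) = N i" by (rule N_eq_if_collinear)
  with opp N0 show False by simp
qed

lemma miter_Suc: "miter (i + 1) = (N i + N (i + 1)) /\<^sub>R (1 + N i \<bullet> N (i + 1))"
  using N_add_length [of i] by (simp add: miter_def Let_def)

lemma miter_inner_normals: "miter (i + 1) \<bullet> N i = 1" "miter (i + 1) \<bullet> N (i + 1) = 1"
  unfolding miter_Suc by (rule miter_inner; simp add: N_not_opposite [simplified])+

lemma miter_add_length [simp]: "miter (i + length vs) = miter i"
proof -
  have shift: "i + length vs + length vs - 1 = (i + length vs - 1) + length vs"
    using nonempty by (simp add: Suc_le_eq)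
  have "N (i + length vs + length vs - 1) = N (i + length vs - 1)"
    unfolding shift by (rule N_add_length)
  then show ?thesis by (simp add: miter_def)
qed

lemma shifted_line_eq: "shifted_line vs es \<delta> i = {p. (p - V i) \<bullet> N i = \<delta>}"
proof (intro subset_antisym subsetI)
  fix p assume "p \<in> shifted_line vs es \<delta> i"
  then obtain s t where st: "s + t = 1" "p = s *\<^sub>R V i + t *\<^sub>R V (i + 1) + \<delta> *\<^sub>R N i"
    by (auto simp: shifted_line_def affine_hull_2)
  have "s = 1 - t" using st by simp
  then have "p - V i = t *\<^sub>R (V (i + 1) - V i) + \<delta> *\<^sub>R N i"
    unfolding st(2) \<open>s = 1 - t\<close> by (simp add: algebra_simps)
  moreover have "(V (i + 1) - V i) \<bullet> N i = 0"
    unfolding side_vec by (simp add: inner_complex_def)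
  ultimately show "p \<in> {p. (p - V i) \<bullet> N i = \<delta>}"
    by (simp add: inner_add_left dot_square_norm)
next
  fix p assume "p \<in> {p. (p - V i) \<bullet> N i = \<delta>}"
  then have p: "N i \<bullet> (p - V i - \<delta> *\<^sub>R N i) = 0"
    by (simp add: inner_diff_right dot_square_norm inner_commute)
  have "N i \<noteq> 0" using norm_N [of i] by force
  then obtain c where c: "p - V i - \<delta> *\<^sub>R N i = of_real c * (\<i> * N i)"
    using p inner_eq_0_imp_parallel by blast
  define l where "l = dist (V i) (V (i + 1))"
  define t where "t = c * sgn_side i / l"
  have "l \<noteq> 0" using V_neq [of i] by (simp add: l_def)
  then have "of_real c * (\<i> * N i) = t *\<^sub>R (V (i + 1) - V i)"
    unfolding side_vec l_def [symmetric] t_def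
    using cyc_es_cases [of i] by (auto simp: scaleR_conv_of_real)
  then have "p = ((1 - t) *\<^sub>R V i + t *\<^sub>R V (i + 1)) + \<delta> *\<^sub>R N i"
    using c by (simp add: algebra_simps)
  then show "p \<in> shifted_line vs es \<delta> i"
    unfolding shifted_line_def affine_hull_2
    by (intro image_eqI [of _ _ "(1 - t) *\<^sub>R V i + t *\<^sub>R V (i + 1)"])
      (simp, intro CollectI exI [of _ "1 - t"] exI [of _ t], simp)
qed

lemma shifted_vertex_eq: "shifted_vertex vs es \<delta> i = V i + \<delta> *\<^sub>R miter i"
proof -
  define j where "j = i + length vs - 1"
  have j: "j + 1 = i + length vs" using nonempty by (simp add: j_def)
  then have j2: "j + 2 = (i + 1) + length vs" by simp
  have Vj: "V (j + 1) = V i" "V (j + 2) = V (i + 1)" and Nj: "N (j + 1) = N i"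
    and Mj: "miter (j + 1) = miter i"
    by (simp_all only: j j2 cyc_add_length N_add_length miter_add_length)
  have m: "miter i \<bullet> N j = 1" "miter i \<bullet> N i = 1"
    using miter_inner_normals [of j] by (simp_all only: Nj Mj)
  show ?thesis
  proof (cases "collinear {V j, V i, V (i + 1)}")
    case True
    then have "N i = N j"
      using N_eq_if_collinear [of j] by (simp only: Vj Nj)
    moreover have "miter i = (N j + N i) /\<^sub>R (1 + N j \<bullet> N i)"
      using miter_Suc [of j] by (simp only: Mj Nj)
    ultimately have "miter i = N i"
      by (simp add: dot_square_norm flip: scaleR_2)
    then show ?thesis
      using True by (simp add: shifted_vertex_def Let_def j_def)
  next
    case False
    have "(V i - V j) \<bullet> N j = 0"
      using side_vec [of j] unfolding Vj by (simp add: inner_complex_def)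
    then have line_j: "shifted_line vs es \<delta> j = {p. (p - V i) \<bullet> N j = \<delta>}"
      by (auto simp: shifted_line_eq inner_diff_left)
    have "(THE p. p \<in> shifted_line vs es \<delta> j \<and> p \<in> shifted_line vs es \<delta> i) = V i + \<delta> *\<^sub>R miter i"
    proof (rule the_equality)
      show "V i + \<delta> *\<^sub>R miter i \<in> shifted_line vs es \<delta> j \<and> V i + \<delta> *\<^sub>R miter i \<in> shifted_line vs es \<delta> i"
        by (simp add: line_j shifted_line_eq [of \<delta> i] m)
    next
      fix p assume "p \<in> shifted_line vs es \<delta> j \<and> p \<in> shifted_line vs es \<delta> i"
      then have "(p - (V i + \<delta> *\<^sub>R miter i)) \<bullet> N j = 0" "(p - (V i + \<delta> *\<^sub>R miter i)) \<bullet> N (j + 1) = 0"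
        by (simp_all only: line_j shifted_line_eq [of \<delta> i] m Nj mem_Collect_eq) (simp_all add: m inner_diff_left inner_add_left)
      then have "p - (V i + \<delta> *\<^sub>R miter i) = 0"
        using collinear_if_common_normal [of "p - (V i + \<delta> *\<^sub>R miter i)" j] False by (simp only: Vj) blast
      then show "p = V i + \<delta> *\<^sub>R miter i" by simp
    qed
    then show ?thesis
      using False by (simp add: shifted_vertex_def Let_def j_def)
  qed
qed

lemma length_shifted_polygon [simp]: "length (shifted_polygon vs es \<delta>) = length vs"
  by (simp add: shifted_polygon_def)

lemma cyc_shifted_polygon:
  assumes "i \<le> length vs"
  shows "cyc (shifted_polygon vs es \<delta>) i = V i + \<delta> *\<^sub>R miter i"
proof (cases "i = length vs")
  case True
  then show ?thesis
    using nonempty cyc_add_length [of vs 0] miter_add_length [of 0]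
    by (simp add: cyc_def shifted_polygon_def shifted_vertex_eq)
next
  case False
  then show ?thesis
    using assms by (simp add: cyc_def shifted_polygon_def shifted_vertex_eq)
qed

section \<open>Lattice points of the pushed polygon\<close>

text \<open>
  The limit of the turn of pushed side \<open>i\<close> around a point \<open>u\<close> of that side. Before the push the
  turn is \<open>0\<close> by convention, so this is also the change caused by the push.
\<close>

definition pushed_gain :: "nat \<Rightarrow> complex \<Rightarrow> real" where
  "pushed_gain i u =
     ((if u = V (i + 1) then Arg (miter (i + 1) / N i) else sgn_side i * pi / 2) +
      (if u = V i then Arg (N i / miter i) else sgn_side i * pi / 2)) / (2 * pi)"

lemma eventually_loop_winding_shifted:
  "\<forall>\<^sub>F \<delta> in at_right 0. loop_winding (shifted_polygon vs es \<delta>) u =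
     pv_winding vs u + (\<Sum>i<length vs. if u \<in> side vs i then pushed_gain i u else 0)"
proof -
  let ?a = "\<lambda>\<delta> i. V i + \<delta> *\<^sub>R miter i"
  have lim: "((\<lambda>\<delta>. turn u (?a \<delta> i) (?a \<delta> (i + 1))) \<longlongrightarrow>
              turn u (V i) (V (i + 1)) + (if u \<in> side vs i then pushed_gain i u else 0)) (at_right 0) \<and>
        (\<forall>\<^sub>F \<delta> in at_right 0. u \<notin> closed_segment (?a \<delta> i) (?a \<delta> (i + 1)))" for i
  proof (cases "u \<in> side vs i")
    case True
    have "miter i \<bullet> N i = 1"
      using miter_inner_normals(2) [of "i + length vs - 1"] nonempty by simp
    then show ?thesis
      using tendsto_turn_pushed_side [OF norm_N _ _ sgn_side_cases _ side_vec [of i], where p = "miter i" and q = "miter (i + 1)"]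
        miter_inner_normals(1) [of i] V_neq [of i] True
      by (simp add: side_def pushed_gain_def turn_def)
  next
    case False
    have "((\<lambda>\<delta>. ?a \<delta> k) \<longlongrightarrow> V k + 0 *\<^sub>R miter k) (at_right 0)" for k
      by (intro tendsto_intros)
    then have "((\<lambda>\<delta>. ?a \<delta> k) \<longlongrightarrow> V k) (at_right 0)" for k by simp
    then show ?thesis
      using False tendsto_turn_off_segment [of u "V i" "V (i + 1)" "\<lambda>\<delta>. ?a \<delta> i" _ "\<lambda>\<delta>. ?a \<delta> (i + 1)"]
      by (simp add: side_def)
  qed
  have side: "side (shifted_polygon vs es \<delta>) i = closed_segment (?a \<delta> i) (?a \<delta> (i + 1))"
    if "i < length vs" for \<delta> i
    using that by (simp add: side_def cyc_shifted_polygon)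
  have "\<forall>\<^sub>F \<delta> in at_right 0. \<forall>i\<in>{..<length vs}. u \<notin> closed_segment (?a \<delta> i) (?a \<delta> (i + 1))"
    by (rule eventually_ball_finite) (use lim in auto)
  then have off: "\<forall>\<^sub>F \<delta> in at_right 0. u \<notin> (\<Union>i<length (shifted_polygon vs es \<delta>). side (shifted_polygon vs es \<delta>) i)"
    by eventually_elim (auto simp: side)
  have nonempty': "shifted_polygon vs es \<delta> \<noteq> []" for \<delta>
    using nonempty by (simp add: shifted_polygon_def)
  have "((\<lambda>\<delta>. \<Sum>i<length vs. turn u (?a \<delta> i) (?a \<delta> (i + 1))) \<longlongrightarrow>
     (\<Sum>i<length vs. turn u (V i) (V (i + 1)) + (if u \<in> side vs i then pushed_gain i u else 0))) (at_right 0)"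
    by (intro tendsto_sum) (use lim in blast)
  moreover have "\<forall>\<^sub>F \<delta> in at_right 0. (\<Sum>i<length vs. turn u (?a \<delta> i) (?a \<delta> (i + 1))) =
     loop_winding (shifted_polygon vs es \<delta>) u"
    using off by eventually_elim
      (simp add: loop_winding_eq_pv_winding nonempty' pv_winding_def cyc_shifted_polygon)
  ultimately have "((\<lambda>\<delta>. loop_winding (shifted_polygon vs es \<delta>) u) \<longlongrightarrow>
     pv_winding vs u + (\<Sum>i<length vs. if u \<in> side vs i then pushed_gain i u else 0)) (at_right 0)"
    by (simp add: pv_winding_def sum.distrib) (rule Lim_transform_eventually)
  then show ?thesis
    by (rule eventually_eq_limit_if_Ints)
      (use off in eventually_elim, rule loop_winding_Ints [OF nonempty'])
qed

text \<open>
  All lattice points of the side except one endpoint contribute \<open>sgn_side i * pi / 2\<close> to each of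
  the two angles in \<open>pushed_gain\<close>; the missing endpoint is a different one for the two angles.
\<close>
lemma sum_pushed_gain_side:
  "(\<Sum>u\<in>side vs i \<inter> lattice. pushed_gain i u) =
     1 / 2 * (sgn_side i * (real (card (side vs i \<inter> lattice)) - 1)) +
     (Arg (miter (i + 1) / N i) + Arg (N i / miter i)) / (2 * pi)"
proof -
  let ?S = "side vs i \<inter> lattice"
  have fin: "finite ?S"
    by (intro finite_bounded_lattice) (simp add: side_def compact_imp_bounded)
  have single: "(\<Sum>u\<in>?S. if u = w then g else h) = g + (real (card ?S) - 1) * h"
    if w: "w \<in> ?S" for w and g h :: real
  proof -
    have "card ?S \<ge> 1" using fin w by (metis One_nat_def Suc_leI card_gt_0_iff empty_iff)
    moreover have "(\<Sum>u\<in>?S. if u = w then g else h) = g + (\<Sum>u\<in>?S - {w}. if u = w then g else h)"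
      using fin w by (subst sum.remove [of _ w]) auto
    moreover have "(\<Sum>u\<in>?S - {w}. if u = w then g else h) = (\<Sum>u\<in>?S - {w}. h)"
      by (rule sum.cong) auto
    ultimately show ?thesis
      using fin w by (simp add: of_nat_diff)
  qed
  have "V i \<in> ?S" "V (i + 1) \<in> ?S"
    by (simp_all add: side_def V_lattice del: One_nat_def)
  then show ?thesis
    by (simp only: pushed_gain_def sum.distrib single flip: sum_divide_distrib) (simp add: field_simps)
qed

text \<open>
  After a cyclic shift of one summand, the two angles at a vertex are those from one normal to the
  direction of \<open>miter\<close> and from there to the next normal. Both are less than a right angle in absolute
  value, so they add up to the angle between the normals without a jump by \<open>2 * pi\<close>.
\<close>
lemma sum_Arg_miter:
  "(\<Sum>i<length vs. (Arg (miter (i + 1) / N i) + Arg (N i / miter i)) / (2 * pi)) = C_term vs es"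
proof -
  have angle: "Arg (miter (i + 1) / N i) + Arg (N (i + 1) / miter (i + 1)) = Arg (N (i + 1) / N i)" for i
  proof -
    let ?m = "miter (i + 1)"
    have "Re (?m / N i) > 0" and m: "Re (?m / N (i + 1)) > 0"
      using miter_inner_normals [of i] by (simp_all add: Re_divide_eq_inner del: One_nat_def)
    moreover have "?m \<noteq> 0" using m by auto
    moreover have "Re (N (i + 1) / ?m) > 0"
      using m Re_inverse_pos_iff [of "?m / N (i + 1)"] by (simp only: inverse_divide)
    ultimately show ?thesis
      using Arg_mult_Re_pos(1) [of "?m / N i" "N (i + 1) / ?m"] by simp
  qed
  have "(\<Sum>i<length vs. Arg (N i / miter i)) = (\<Sum>i<length vs. Arg (N (i + 1) / miter (i + 1)))"
    by (rule sum_cyclic_shift [symmetric]) (use N_add_length [of 0] miter_add_length [of 0] in simp)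
  then have "(\<Sum>i<length vs. Arg (miter (i + 1) / N i) + Arg (N i / miter i)) =
      (\<Sum>i<length vs. Arg (N (i + 1) / N i))"
    by (simp only: sum.distrib flip: angle)
  then show ?thesis
    by (simp add: C_term_def flip: sum_divide_distrib)
qed

text \<open>
  The winding numbers vanish outside a ball that contains the loop and all its pushes with
  \<open>\<delta> < 1\<close>. The ball has only finitely many lattice points, so one bound on \<open>\<delta>\<close> serves for all
  of them.
\<close>
lemma generalized_pick:
  "\<forall>\<^sub>F \<delta> in at_right 0. sharp vs es \<delta> = A_term vs + 1 / 2 * B_term vs es + C_term vs es"
proof -
  let ?gain = "\<lambda>u i. if u \<in> side vs i then pushed_gain i u else 0"
  define R where "R = (\<Sum>i<length vs. norm (V i) + norm (miter i))"
  define K where "K = cball 0 R \<inter> lattice"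
  have K: "finite K" "K \<subseteq> lattice"
    by (simp_all add: K_def finite_bounded_lattice)
  have bound: "norm (V i) + norm (miter i) \<le> R" if "i < length vs" for i
    unfolding R_def using that by (intro member_le_sum [where f = "\<lambda>i. norm (V i) + norm (miter i)"]) auto
  have V_ball: "V i \<in> cball 0 R" for i
  proof -
    have "V i = V (i mod length vs)" by (simp add: cyc_def)
    moreover have il: "i mod length vs < length vs" using nonempty by simp
    have "norm (V (i mod length vs)) \<le> R"
      using bound [OF il] norm_ge_zero [of "miter (i mod length vs)"] by linarith
    ultimately show ?thesis by simp
  qed
  then have side_ball: "side vs i \<subseteq> cball 0 R" for i
    by (simp add: side_def closed_segment_subset)
  have inK: "\<forall>\<^sub>F \<delta> in at_right 0. \<forall>u\<in>K. loop_winding (shifted_polygon vs es \<delta>) u =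
       pv_winding vs u + (\<Sum>i<length vs. ?gain u i)"
    by (rule eventually_ball_finite) (use K eventually_loop_winding_shifted in auto)
  have "\<forall>\<^sub>F \<delta> in at_right 0. \<delta> \<in> {0<..<1::real}"
    by (rule eventually_at_right_real) simp
  with inK have "\<forall>\<^sub>F \<delta> in at_right 0. sharp vs es \<delta> = (\<Sum>u\<in>K. pv_winding vs u + (\<Sum>i<length vs. ?gain u i))"
  proof eventually_elim
    case (elim \<delta>)
    have "set (shifted_polygon vs es \<delta>) \<subseteq> cball 0 R"
    proof
      fix w assume "w \<in> set (shifted_polygon vs es \<delta>)"
      then obtain i where i: "i < length vs" "w = V i + \<delta> *\<^sub>R miter i"
        by (auto simp: shifted_polygon_def shifted_vertex_eq)
      have "norm (\<delta> *\<^sub>R miter i) \<le> norm (miter i)"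
        using elim(2) by (simp add: mult_left_le_one_le)
      then have "norm w \<le> norm (V i) + norm (miter i)"
        unfolding i(2) by (meson norm_triangle_ineq add_left_mono order_trans)
      then show "w \<in> cball 0 R"
        using bound [OF i(1)] by simp
    qed
    then have out: "loop_winding (shifted_polygon vs es \<delta>) u = 0" if "u \<notin> cball 0 R" for u
      using that nonempty by (intro loop_winding_outside [where S = "cball 0 R"]) (simp_all add: shifted_polygon_def)
    have "sharp vs es \<delta> = (\<Sum>\<^sub>\<infinity>u\<in>K. loop_winding (shifted_polygon vs es \<delta>) u)"
      unfolding sharp_def by (rule infsum_cong_neutral) (use out in \<open>auto simp: K_def\<close>)
    then show ?case
      using K elim(1) by simp
  qed
  moreover have "(\<Sum>u\<in>K. pv_winding vs u) = A_term vs"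
  proof -
    have "pv_winding vs u = 0" if u: "u \<notin> cball 0 R" for u
    proof -
      have "u \<notin> (\<Union>i<length vs. side vs i)" using u side_ball by blast
      then have "pv_winding vs u = loop_winding vs u"
        by (simp add: loop_winding_eq_pv_winding nonempty)
      also have "\<dots> = 0"
      proof (rule loop_winding_outside [OF nonempty _ convex_cball u])
        show "set vs \<subseteq> cball 0 R"
          using V_ball by (auto simp: in_set_conv_nth cyc_def) (metis mod_less)
      qed
      finally show ?thesis .
    qed
    then have "(\<Sum>\<^sub>\<infinity>u\<in>lattice. pv_winding vs u) = (\<Sum>\<^sub>\<infinity>u\<in>K. pv_winding vs u)"
      by (intro infsum_cong_neutral) (auto simp: K_def)
    then show ?thesis
      using K by (simp add: A_term_eq_infsum_pv_winding nonempty vertices_lattice)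
  qed
  moreover have "(\<Sum>u\<in>K. \<Sum>i<length vs. ?gain u i) = 1 / 2 * B_term vs es + C_term vs es"
  proof -
    have "(\<Sum>u\<in>K. ?gain u i) = (\<Sum>u\<in>side vs i \<inter> lattice. pushed_gain i u)" for i
      by (rule sum.mono_neutral_cong_right) (use K side_ball [of i] in \<open>auto simp: K_def\<close>)
    then have "(\<Sum>u\<in>K. \<Sum>i<length vs. ?gain u i) =
        (\<Sum>i<length vs. 1 / 2 * (sgn_side i * (real (card (side vs i \<inter> lattice)) - 1)) +
           (Arg (miter (i + 1) / N i) + Arg (N i / miter i)) / (2 * pi))"
      by (subst sum.swap) (simp only: sum_pushed_gain_side)
    also have "\<dots> = 1 / 2 * B_term vs es + C_term vs es"
      by (simp only: sum.distrib sum_Arg_miter B_term_def sum_distrib_left)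
    finally show ?thesis .
  qed
  ultimately show ?thesis
    by (simp add: sum.distrib add.assoc)
qed

end

theorem theorem3p1:
  fixes vs :: "complex list" and es :: "int list"
  assumes "lattice_multi_polygon vs es"
  shows "\<forall>\<^sub>F \<delta> in at_right 0.
           sharp vs es \<delta> = A_term vs + 1 / 2 * B_term vs es + C_term vs es"
proof -
  interpret multi_polygon vs es by unfold_locales (rule assms)
  show ?thesis by (rule generalized_pick)
qed

end
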